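(* Let $\theta\in\mathbb{R}$. For every left $H$-comodule $(V,\rho)$, define a linear isomorphism $L_V\colon A\,\square_H V\to A_\theta\,\square_H V$ by setting $$L_V(a\otimes v)=e^{\pi i\theta mn}\,a\otimes v$$ for all homogeneous elements $a\otimes v\in A^{((m+n,-m),n)}\otimes V^n$, $m,n\in\mathbb{Z}$. Then $L_V$ is an isomorphism of left $B$-modules from $E_A(V)$ to $E_{A_\theta}(V)$. Moreover, the maps $L_V$ are the components of a natural isomorphism $L\colon E_A\Rightarrow E_{A_\theta}$ between the associated module functors $E_A,E_{A_\theta}\colon {}^H\mathscr{M}\to{}_B\mathscr{M}$ (from left $H$-comodules to left $B$-modules) of the classical Hopf fibration $(A,\delta)$ and of the deformed Hopf fibration $(A_\theta,\delta)$.
   Context: Algebras are associative and unital over $\mathbb{C}$, $\otimes=\otimes_{\mathbb{C}}$. Sweedler notation: $\delta(a)=a_{\underline{0}}\otimes a_{\underline{1}}$ for right coactions, $\rho(a)=a_{\underline{-1}}\otimes a_{\underline{0}}$ for left coactions. $A=\mathcal{O}(\mathbb{S}^3)$ is the commutative $\ast$-algebra generated by $z_1,z_2$ modulo the $\ast$-ideal generated by the relation $z_1^\ast z_1+z_2^\ast z_2=\mathbf{1}$. $H=\mathcal{O}(U(1))$ is the commutative $\ast$-Hopf algebra generated by $t$ with $t^\ast t=\mathbf{1}$ (so $t^\ast=t^{-1}$), $\Delta(t)=t\otimes t$, $\epsilon(t)=1$, $S(t)=t^\ast$. $\delta\colon A\to A\otimes H$ is the right $H$-coaction ($\ast$-algebra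 map) with $\delta(z_i)=z_i\otimes t$, $\delta(z_i^\ast)=z_i^\ast\otimes t^\ast$. $K=\mathcal{O}(\mathbb{T}^2)$ is the Hopf algebra with basis $\{t_{\mathbf m}:\mathbf m=(m_1,m_2)\in\mathbb{Z}^2\}$, $t_{\mathbf m}t_{\mathbf m'}=t_{\mathbf m+\mathbf m'}$, $\mathbf 1=t_{\mathbf 0}$, $t_{\mathbf m}^\ast=t_{-\mathbf m}$, $\Delta(t_{\mathbf m})=t_{\mathbf m}\otimes t_{\mathbf m}$, $\epsilon(t_{\mathbf m})=1$, $S(t_{\mathbf m})=t_{-\mathbf m}$. $\rho\colon A\to K\otimes A$ is the left $K$-coaction ($\ast$-algebra map) with $\rho(z_1)=t_{(1,0)}\otimes z_1$, $\rho(z_2)=t_{(0,1)}\otimes z_2$, $\rho(z_1^\ast)=t_{(-1,0)}\otimes z_1^\ast$, $\rho(z_2^\ast)=t_{(0,-1)}\otimes z_2^\ast$. For $\theta\in\mathbb{R}$ let $\sigma_\theta(t_{\mathbf m}\otimes t_{\mathbf m'})=\exp\big(\pi i\theta(m_1m_2'-m_2m_1')\big)$. The deformed algebra $A_\theta$ has the same underlying vector space, unit, involution and coactions $\rho,\delta$ as $A$, with product $a\star_\theta a'=\sigma_\theta(a_{\underline{-1}}\otimes a'_{\underline{-1}})\,a_{\underline 0}a'_{\underline 0}$. $B:=A^{\mathrm{co}H}=\{a\in A:\delta(a)=a\otimes\mathbf 1\}$; it coincides with $A_\theta^{\mathrm{co}H}$ as an algebra (the products of $A$ and $A_\theta$ agree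 on $B$). $A^{(\mathbf m,n)}=\{a\in A:\rho(a)=t_{\mathbf m}\otimes a,\ \delta(a)=a\otimes t^n\}$; one has $A=\bigoplus_{m,n\in\mathbb{Z}}A^{((m+n,-m),n)}$. For a left $H$-comodule $(V,\rho)$, $V^n=\{v\in V:\rho(v)=t^n\otimes v\}$. The cotensor product of a right $H$-comodule $(M,\delta)$ with a left $H$-comodule $(V,\rho)$ is $M\,\square_HV=\{\sum_j m_j\otimes v_j\in M\otimes V:\sum_j\delta(m_j)\otimes v_j=\sum_j m_j\otimes\rho(v_j)\}$. The associated module functors are $E_A(V)=A\,\square_HV$ with left $B$-action $b\,(a\otimes v)=(ba)\otimes v$, and $E_{A_\theta}(V)=A_\theta\,\square_HV$ with left $B$-action $b\star_\theta(a\otimes v)=(b\star_\theta a)\otimes v$; on morphisms $f$ they act as $\mathrm{id}\otimes f$. As vector spaces $A\,\square_HV=A_\theta\,\square_HV=\bigoplus_{m,n\in\mathbb{Z}}A^{((m+n,-m),n)}\otimes V^n$. *)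

theory Defs
  imports Complex_Main
    "HOL-Library.Poly_Mapping" "HOL-Library.Product_Plus" "HOL-Library.FuncSet"
begin

section \<open>Complex vector spaces and commutative algebras\<close>

class complex_vector = ab_group_add +
  fixes scaleC :: "complex \<Rightarrow> 'a \<Rightarrow> 'a"  (infixr \<open>*\<^sub>C\<close> 75)
  assumes scaleC_add_right: "c *\<^sub>C (x + y) = c *\<^sub>C x + c *\<^sub>C y"
    and scaleC_add_left: "(c + d) *\<^sub>C x = c *\<^sub>C x + d *\<^sub>C x"
    and scaleC_scaleC [simp]: "c *\<^sub>C d *\<^sub>C x = (c * d) *\<^sub>C x"
    and scaleC_one [simp]: "1 *\<^sub>C x = x"

global_interpretation cvs: vector_space "scaleC :: complex \<Rightarrow> 'a \<Rightarrow> 'a::complex_vector"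
  by unfold_locales (simp_all add: scaleC_add_right scaleC_add_left)

abbreviation clinear :: "('a::complex_vector \<Rightarrow> 'b::complex_vector) \<Rightarrow> bool"
  where "clinear \<equiv> Vector_Spaces.linear scaleC scaleC"

lemma clinear_iff:
  "clinear f \<longleftrightarrow> (\<forall>x y. f (x + y) = f x + f y) \<and> (\<forall>c x. f (c *\<^sub>C x) = c *\<^sub>C f x)"
  by (simp add: Vector_Spaces.linear_iff cvs.vector_space_axioms)

definition cbilinear ::
    "('a::complex_vector \<Rightarrow> 'b::complex_vector \<Rightarrow> 'c::complex_vector) \<Rightarrow> bool"
  where "cbilinear f \<longleftrightarrow> (\<forall>b. clinear (\<lambda>a. f a b)) \<and> (\<forall>a. clinear (f a))"

class comm_calgebra = complex_vector + comm_ring_1 +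
  assumes scaleC_mult_left [simp]: "(c *\<^sub>C x) * y = c *\<^sub>C (x * y)"

lemma scaleC_mult_right [simp]: "x * (c *\<^sub>C y) = c *\<^sub>C (x * (y::'a::comm_calgebra))"
  by (metis mult.commute scaleC_mult_left)

instantiation complex :: comm_calgebra
begin
definition scaleC_complex :: "complex \<Rightarrow> complex \<Rightarrow> complex" where
  [simp]: "c *\<^sub>C z = c * (z::complex)"
instance by standard (simp_all add: algebra_simps)
end

lemma functional_exists:
  fixes x :: "'a::complex_vector"
  assumes "x \<noteq> 0"
  obtains f :: "'a \<Rightarrow> complex" where "clinear f" "f x = 1"
proof -
  interpret vector_space_pair "scaleC :: complex \<Rightarrow> 'a \<Rightarrow> 'a" "scaleC :: complex \<Rightarrow> complex \<Rightarrow> complex"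
    by unfold_locales
  have "cvs.independent {x}" using assms by simp
  from linear_independent_extend[OF this, of "\<lambda>_. 1"] that show ?thesis by auto
qed

subsection \<open>Finitely supported functions\<close>

instantiation poly_mapping :: (type, complex_vector) complex_vector
begin
lift_definition scaleC_poly_mapping :: "complex \<Rightarrow> ('a \<Rightarrow>\<^sub>0 'b) \<Rightarrow> 'a \<Rightarrow>\<^sub>0 'b"
  is "\<lambda>c p k. c *\<^sub>C p k"
  by (erule rev_finite_subset) (auto intro: ccontr)
instance
  by standard (transfer; simp add: fun_eq_iff scaleC_add_right scaleC_add_left)+
end

lemma lookup_scaleC [simp]: "Poly_Mapping.lookup (c *\<^sub>C p) k = c *\<^sub>C Poly_Mapping.lookup p k"
  by transfer simp

lemma scaleC_single [simp]:
  "c *\<^sub>C Poly_Mapping.single k d = Poly_Mapping.single k (c *\<^sub>C d)"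
  by (rule poly_mapping_eqI) (simp add: lookup_single when_def)

lemma poly_mapping_sum_single:
  "(\<Sum>k\<in>Poly_Mapping.keys p. Poly_Mapping.single k (Poly_Mapping.lookup p k)) = p"
proof (rule poly_mapping_eqI)
  fix j
  have "(\<Sum>k\<in>Poly_Mapping.keys p. (Poly_Mapping.lookup p k when k = j)) =
      (\<Sum>k\<in>Poly_Mapping.keys p. if k = j then Poly_Mapping.lookup p k else 0)"
    by (simp add: when_def)
  then show "Poly_Mapping.lookup
        (\<Sum>k\<in>Poly_Mapping.keys p. Poly_Mapping.single k (Poly_Mapping.lookup p k)) j
      = Poly_Mapping.lookup p j"
    by (simp add: lookup_sum lookup_single in_keys_iff)
qed

lemma poly_mapping_single_induct [case_names zero single add]:
  fixes p :: "'a \<Rightarrow>\<^sub>0 'b::comm_monoid_add"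
  assumes "P 0" "\<And>k c. P (Poly_Mapping.single k c)" "\<And>p q. P p \<Longrightarrow> P q \<Longrightarrow> P (p + q)"
  shows "P p"
proof -
  have "P (\<Sum>k\<in>S. Poly_Mapping.single k (f k))" if "finite S" for S f
    using that by induction (auto intro: assms)
  from this[of "Poly_Mapping.keys p" "Poly_Mapping.lookup p"] show ?thesis
    by (simp add: poly_mapping_sum_single)
qed

lemma multiplicative_from_single:
  fixes F :: "('a::monoid_add \<Rightarrow>\<^sub>0 'b::semiring_0) \<Rightarrow> 'c::semiring_0"
  assumes z: "F 0 = 0" and a: "\<And>p q. F (p + q) = F p + F q"
    and s: "\<And>k l c d. F (Poly_Mapping.single (k + l) (c * d)) =
               F (Poly_Mapping.single k c) * F (Poly_Mapping.single l d)"
  shows "F (p * q) = F p * F q"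
proof (induction p rule: poly_mapping_single_induct)
  case (single k c)
  show ?case
    by (induction q rule: poly_mapping_single_induct) (auto simp: z a mult_single s algebra_simps)
qed (auto simp: z a algebra_simps)

instance poly_mapping :: (comm_monoid_add, comm_calgebra) comm_calgebra
proof
  fix c and x y :: "'a \<Rightarrow>\<^sub>0 'b"
  have e: "c *\<^sub>C (Poly_Mapping.single 0 1 * z) = Poly_Mapping.single 0 (c *\<^sub>C 1) * z"
    for z :: "'a \<Rightarrow>\<^sub>0 'b"
    by (induction z rule: poly_mapping_single_induct)
       (auto simp: mult_single scaleC_add_right distrib_left)
  show "(c *\<^sub>C x) * y = c *\<^sub>C (x * y)"
    using e[of x] e[of "x * y"] by (simp add: mult.assoc)
qed

text \<open>The linear extension of a map given on the basis \<open>single k 1\<close>.\<close>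

definition lin_ext :: "('k \<Rightarrow> 'c::complex_vector) \<Rightarrow> ('k \<Rightarrow>\<^sub>0 complex) \<Rightarrow> 'c" where
  "lin_ext f p = (\<Sum>k\<in>Poly_Mapping.keys p. Poly_Mapping.lookup p k *\<^sub>C f k)"

lemma lin_ext_superset:
  assumes "finite S" "Poly_Mapping.keys p \<subseteq> S"
  shows "lin_ext f p = (\<Sum>k\<in>S. Poly_Mapping.lookup p k *\<^sub>C f k)"
  unfolding lin_ext_def using assms
  by (intro sum.mono_neutral_left) (auto simp: in_keys_iff)

lemma lin_ext_zero [simp]: "lin_ext f 0 = 0"
  by (simp add: lin_ext_def)

lemma lin_ext_add: "lin_ext f (p + q) = lin_ext f p + lin_ext f q"
proof -
  let ?S = "Poly_Mapping.keys p \<union> Poly_Mapping.keys q"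
  have "lin_ext f r = (\<Sum>k\<in>?S. Poly_Mapping.lookup r k *\<^sub>C f k)" if "r \<in> {p, q, p + q}" for r
    using that by (intro lin_ext_superset) (auto dest: keys_add[THEN subsetD])
  then show ?thesis
    by (simp add: lookup_add scaleC_add_left sum.distrib)
qed

lemma lin_ext_scaleC: "lin_ext f (c *\<^sub>C p) = c *\<^sub>C lin_ext f p"
proof -
  have "lin_ext f (c *\<^sub>C p) = (\<Sum>k\<in>Poly_Mapping.keys p. (c * Poly_Mapping.lookup p k) *\<^sub>C f k)"
    by (subst lin_ext_superset[where S = "Poly_Mapping.keys p"]) (auto simp: in_keys_iff)
  then show ?thesis
    by (simp add: lin_ext_def cvs.scale_sum_right)
qed

lemma lin_ext_single [simp]: "lin_ext f (Poly_Mapping.single k c) = c *\<^sub>C f k"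
  by (simp add: lin_ext_def)

lemma clinear_lin_ext: "clinear (lin_ext f)"
  by (simp add: clinear_iff lin_ext_add lin_ext_scaleC)

lemma lin_ext_add_fun: "lin_ext (\<lambda>k. f k + g k) p = lin_ext f p + lin_ext g p"
  by (simp add: lin_ext_def scaleC_add_right sum.distrib)

lemma lin_ext_scaleC_fun: "lin_ext (\<lambda>k. c *\<^sub>C f k) p = c *\<^sub>C lin_ext f p"
  by (simp add: lin_ext_def cvs.scale_sum_right mult.commute)

section \<open>Algebraic tensor products over the complex numbers\<close>

definition tensor_relators :: "('a::complex_vector \<times> 'b::complex_vector \<Rightarrow>\<^sub>0 complex) set" where
  "tensor_relators =
     {Poly_Mapping.single (a + a', b) 1 - Poly_Mapping.single (a, b) 1 - Poly_Mapping.single (a', b) 1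
       | a a' b. True} \<union>
     {Poly_Mapping.single (a, b + b') 1 - Poly_Mapping.single (a, b) 1 - Poly_Mapping.single (a, b') 1
       | a b b'. True} \<union>
     {Poly_Mapping.single (c *\<^sub>C a, b) 1 - c *\<^sub>C Poly_Mapping.single (a, b) 1 | c a b. True} \<union>
     {Poly_Mapping.single (a, c *\<^sub>C b) 1 - c *\<^sub>C Poly_Mapping.single (a, b) 1 | c a b. True}"

definition tensor_rel ::
    "('a::complex_vector \<times> 'b::complex_vector \<Rightarrow>\<^sub>0 complex) \<Rightarrow> ('a \<times> 'b \<Rightarrow>\<^sub>0 complex) \<Rightarrow> bool"
  where "tensor_rel p q \<longleftrightarrow> p - q \<in> cvs.span tensor_relators"

lemma equivp_tensor_rel: "equivp tensor_rel"
proof (rule equivpI)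
  show "reflp tensor_rel"
    by (auto simp: reflp_def tensor_rel_def cvs.span_zero)
  show "symp tensor_rel"
    unfolding symp_def tensor_rel_def by (auto dest: cvs.span_neg)
  show "transp tensor_rel"
    unfolding transp_def tensor_rel_def
    by (intro allI impI, drule (1) cvs.span_add) (simp add: algebra_simps)
qed

quotient_type (overloaded) ('a, 'b) tensor =
    "('a::complex_vector \<times> 'b::complex_vector) \<Rightarrow>\<^sub>0 complex" / tensor_rel
  by (rule equivp_tensor_rel)

type_notation tensor  (infixr \<open>\<otimes>\<close> 70)

instantiation tensor :: (complex_vector, complex_vector) complex_vector
begin
lift_definition zero_tensor :: "'a \<otimes> 'b" is 0 .
lift_definition plus_tensor :: "'a \<otimes> 'b \<Rightarrow> 'a \<otimes> 'b \<Rightarrow> 'a \<otimes> 'b" is "(+)"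
  unfolding tensor_rel_def by (drule (1) cvs.span_add) (simp add: algebra_simps)
lift_definition uminus_tensor :: "'a \<otimes> 'b \<Rightarrow> 'a \<otimes> 'b" is uminus
  unfolding tensor_rel_def by (drule cvs.span_neg) (simp add: algebra_simps)
lift_definition minus_tensor :: "'a \<otimes> 'b \<Rightarrow> 'a \<otimes> 'b \<Rightarrow> 'a \<otimes> 'b" is "(-)"
  unfolding tensor_rel_def by (drule (1) cvs.span_diff) (simp add: algebra_simps)
lift_definition scaleC_tensor :: "complex \<Rightarrow> 'a \<otimes> 'b \<Rightarrow> 'a \<otimes> 'b" is scaleC
  unfolding tensor_rel_def by (subst cvs.scale_right_diff_distrib[symmetric]) (rule cvs.span_scale)
instance
  by standard
    (transfer; simp add: tensor_rel_def algebra_simps cvs.span_zero scaleC_add_right scaleC_add_left)+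
end

lift_definition pure_tensor ::
    "'a::complex_vector \<Rightarrow> 'b::complex_vector \<Rightarrow> 'a \<otimes> 'b"  (infixr \<open>\<otimes>\<close> 70)
  is "\<lambda>a b. Poly_Mapping.single (a, b) 1" .

lemma pure_tensor_simps:
  fixes a a' :: "'a::complex_vector" and b b' :: "'b::complex_vector"
  shows "(a + a') \<otimes> b = a \<otimes> b + a' \<otimes> b"
    and "a \<otimes> (b + b') = a \<otimes> b + a \<otimes> b'"
    and "(c *\<^sub>C a) \<otimes> b = c *\<^sub>C (a \<otimes> b)"
    and "a \<otimes> (c *\<^sub>C b) = c *\<^sub>C (a \<otimes> b)"
  by (transfer, unfold tensor_rel_def, rule cvs.span_base,
      force simp: tensor_relators_def diff_diff_eq simp del: scaleC_single)+

lemma cbilinear_pure_tensor: "cbilinear (\<otimes>)"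
  by (simp add: cbilinear_def clinear_iff pure_tensor_simps)

lemma tensor_induct [case_names pure add]:
  assumes pure: "\<And>a b. P (a \<otimes> b)" and add: "\<And>x y. P x \<Longrightarrow> P y \<Longrightarrow> P (x + y)"
  shows "P (x :: 'a::complex_vector \<otimes> 'b::complex_vector)"
proof -
  have z: "(0 :: 'a \<otimes> 'b) = (0 *\<^sub>C 0) \<otimes> 0"
    by (metis pure_tensor_simps(3) cvs.scale_zero_left)
  have abs_add: "abs_tensor (p + q) = abs_tensor p + (abs_tensor q :: 'a \<otimes> 'b)" for p q
    by (simp add: plus_tensor.abs_eq)
  have abs_single: "abs_tensor (Poly_Mapping.single (a, b) c) = (c *\<^sub>C a) \<otimes> b"
    for a :: 'a and b :: 'b and c
    unfolding pure_tensor_simps by (simp add: pure_tensor.abs_eq scaleC_tensor.abs_eq)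
  have "P (abs_tensor p)" for p
  proof (induction p rule: poly_mapping_single_induct)
    case zero
    show ?case unfolding zero_tensor.abs_eq[symmetric] z by (rule pure)
  next
    case (single k c)
    show ?case by (cases k) (simp add: abs_single pure)
  next
    case (add p q)
    then show ?case by (simp add: abs_add assms(2))
  qed
  then show ?thesis by (metis Quotient3_abs_rep Quotient3_tensor)
qed

text \<open>
  The universal property: for a bilinear \<open>f\<close>, \<open>tensor_lift f\<close> is the linear map sending
  \<open>a \<otimes> b\<close> to \<open>f a b\<close>; it carries no meaning for other \<open>f\<close>.
\<close>

definition tensor_lift ::
    "('a::complex_vector \<Rightarrow> 'b::complex_vector \<Rightarrow> 'c::complex_vector) \<Rightarrow> 'a \<otimes> 'b \<Rightarrow> 'c"
  where "tensor_lift f x = lin_ext (case_prod f) (rep_tensor x)"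

lemma tensor_lift_abs:
  assumes f: "cbilinear f"
  shows "tensor_lift f (abs_tensor p) = lin_ext (case_prod f) p"
proof -
  let ?L = "lin_ext (case_prod f)"
  interpret L: Vector_Spaces.linear scaleC scaleC ?L by (rule clinear_lin_ext)
  have "?L q = 0" if "q \<in> cvs.span tensor_relators" for q
    using that
  proof (induction rule: cvs.span_induct_alt)
    case (step c x y)
    have "?L x = 0"
      using step(1) f
      by (auto simp: tensor_relators_def L.diff cbilinear_def clinear_iff)
    with step show ?case by (simp add: L.add L.scale)
  qed simp
  moreover have "tensor_rel (rep_tensor (abs_tensor p)) p"
    using Quotient3_rep_abs[OF Quotient3_tensor] by (simp add: equivp_reflp[OF equivp_tensor_rel])
  ultimately have "?L (rep_tensor (abs_tensor p) - p) = 0"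
    by (simp add: tensor_rel_def)
  then show ?thesis by (simp add: tensor_lift_def L.diff)
qed

lemma tensor_lift_pure [simp]: "cbilinear f \<Longrightarrow> tensor_lift f (a \<otimes> b) = f a b"
  by (simp add: pure_tensor.abs_eq tensor_lift_abs)

lemma clinear_tensor_lift:
  assumes "cbilinear f"
  shows "clinear (tensor_lift f)"
  unfolding clinear_iff
proof (intro conjI allI)
  fix x y :: "'a \<otimes> 'b"
  obtain p q where "x = abs_tensor p" "y = abs_tensor q"
    by (metis Quotient3_abs_rep Quotient3_tensor)
  then show "tensor_lift f (x + y) = tensor_lift f x + tensor_lift f y"
    by (simp add: plus_tensor.abs_eq tensor_lift_abs assms lin_ext_add)
next
  fix c and x :: "'a \<otimes> 'b"
  obtain p where "x = abs_tensor p"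
    by (metis Quotient3_abs_rep Quotient3_tensor)
  then show "tensor_lift f (c *\<^sub>C x) = c *\<^sub>C tensor_lift f x"
    by (simp add: scaleC_tensor.abs_eq tensor_lift_abs assms lin_ext_scaleC)
qed

lemma tensor_lift_add_fun:
  "tensor_lift (\<lambda>a b. f a b + g a b) x = tensor_lift f x + tensor_lift g x"
  by (simp add: tensor_lift_def lin_ext_add_fun[symmetric] case_prod_unfold)

lemma tensor_lift_scaleC_fun: "tensor_lift (\<lambda>a b. c *\<^sub>C f a b) x = c *\<^sub>C tensor_lift f x"
  by (simp add: tensor_lift_def lin_ext_scaleC_fun[symmetric] case_prod_unfold)

definition tensor_map ::
    "('a::complex_vector \<Rightarrow> 'c::complex_vector) \<Rightarrow> ('b::complex_vector \<Rightarrow> 'd::complex_vector) \<Rightarrow>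
     'a \<otimes> 'b \<Rightarrow> 'c \<otimes> 'd"
  where "tensor_map f g = tensor_lift (\<lambda>a b. f a \<otimes> g b)"

lemma cbilinear_tensor_map: "clinear f \<Longrightarrow> clinear g \<Longrightarrow> cbilinear (\<lambda>a b. f a \<otimes> g b)"
  by (simp add: cbilinear_def clinear_iff pure_tensor_simps)

lemma tensor_map_pure [simp]:
  "clinear f \<Longrightarrow> clinear g \<Longrightarrow> tensor_map f g (a \<otimes> b) = f a \<otimes> g b"
  by (simp add: tensor_map_def cbilinear_tensor_map)

lemma clinear_tensor_map: "clinear f \<Longrightarrow> clinear g \<Longrightarrow> clinear (tensor_map f g)"
  by (simp add: tensor_map_def cbilinear_tensor_map clinear_tensor_lift)

definition tensor_assoc ::
    "('a::complex_vector \<otimes> 'b::complex_vector) \<otimes> 'c::complex_vector \<Rightarrow> 'a \<otimes> 'b \<otimes> 'c"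
  where "tensor_assoc = tensor_lift (\<lambda>x c. tensor_lift (\<lambda>a b. a \<otimes> b \<otimes> c) x)"

lemma cbilinear_tensor_assoc:
  "cbilinear (\<lambda>(x :: 'a::complex_vector \<otimes> 'b::complex_vector) (c::'c::complex_vector).
     tensor_lift (\<lambda>a b. a \<otimes> b \<otimes> c) x)"
proof -
  have "cbilinear (\<lambda>(a::'a) (b::'b). a \<otimes> b \<otimes> c)" for c :: 'c
    by (simp add: cbilinear_def clinear_iff pure_tensor_simps)
  then have "clinear (tensor_lift (\<lambda>(a::'a) (b::'b). a \<otimes> b \<otimes> c))" for c :: 'c
    by (rule clinear_tensor_lift)
  then show ?thesis
    unfolding cbilinear_def
    by (simp add: clinear_iff pure_tensor_simps tensor_lift_add_fun tensor_lift_scaleC_fun)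
qed

lemma clinear_tensor_assoc: "clinear tensor_assoc"
  unfolding tensor_assoc_def by (rule clinear_tensor_lift[OF cbilinear_tensor_assoc])

lemma tensor_assoc_pure [simp]:
  fixes a :: "'a::complex_vector" and b :: "'b::complex_vector" and c :: "'c::complex_vector"
  shows "tensor_assoc ((a \<otimes> b) \<otimes> c) = a \<otimes> b \<otimes> c"
proof -
  have "cbilinear (\<lambda>(a::'a) (b::'b). a \<otimes> b \<otimes> c)"
    by (simp add: cbilinear_def clinear_iff pure_tensor_simps)
  then show ?thesis
    by (simp add: tensor_assoc_def cbilinear_tensor_assoc)
qed

lemma tensor_mult_inner:
  "cbilinear (\<lambda>c d. (a * c) \<otimes> (b * d))" for a :: "'a::comm_calgebra" and b :: "'b::comm_calgebra"
  by (simp add: cbilinear_def clinear_iff pure_tensor_simps distrib_left)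

lemma tensor_mult_inner':
  "cbilinear (\<lambda>a b. (a * c) \<otimes> (b * d))" for c :: "'a::comm_calgebra" and d :: "'b::comm_calgebra"
  by (simp add: cbilinear_def clinear_iff pure_tensor_simps distrib_right)

lemma tensor_mult_outer:
  "cbilinear (\<lambda>a b. tensor_lift (\<lambda>c d. (a * c) \<otimes> (b * d)) y)"
  for y :: "'a::comm_calgebra \<otimes> 'b::comm_calgebra"
  by (simp add: cbilinear_def clinear_iff pure_tensor_simps distrib_right
      tensor_lift_add_fun tensor_lift_scaleC_fun)

instantiation tensor :: (comm_calgebra, comm_calgebra) comm_calgebra
begin

definition one_tensor :: "'a \<otimes> 'b" where "1 = 1 \<otimes> 1"

definition times_tensor :: "'a \<otimes> 'b \<Rightarrow> 'a \<otimes> 'b \<Rightarrow> 'a \<otimes> 'b" where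
  "x * y = tensor_lift (\<lambda>a b. tensor_lift (\<lambda>c d. (a * c) \<otimes> (b * d)) y) x"

instance
proof
  fix c :: complex and x y z :: "'a \<otimes> 'b"
  have mult_pure: "(a \<otimes> b) * (a' \<otimes> b') = (a * a') \<otimes> (b * b')" for a a' :: 'a and b b' :: 'b
    by (simp add: times_tensor_def tensor_mult_inner tensor_mult_inner' tensor_mult_outer)
  show add_mult: "(x + y) * z = x * z + y * z" for x y z :: "'a \<otimes> 'b"
    using clinear_tensor_lift[OF tensor_mult_outer[of z]]
    by (simp add: times_tensor_def clinear_iff)
  have mult_add: "x * (y + z) = x * y + x * z" for x y z :: "'a \<otimes> 'b"
  proof -
    have "tensor_lift (\<lambda>c d. (a * c) \<otimes> (b * d)) (y + z) =
        tensor_lift (\<lambda>c d. (a * c) \<otimes> (b * d)) y + tensor_lift (\<lambda>c d. (a * c) \<otimes> (b * d)) z"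
      for a :: 'a and b :: 'b
      using clinear_tensor_lift[OF tensor_mult_inner[of a b]] by (simp add: clinear_iff)
    then show ?thesis by (simp add: times_tensor_def tensor_lift_add_fun)
  qed
  show "(c *\<^sub>C x) * y = c *\<^sub>C (x * y)"
    using clinear_tensor_lift[OF tensor_mult_outer[of y]]
    by (simp add: times_tensor_def clinear_iff)
  show "x * y = y * x"
  proof (induction x rule: tensor_induct)
    case (pure a b)
    show ?case
      by (induction y rule: tensor_induct) (simp_all add: mult_pure mult.commute add_mult mult_add)
  qed (simp add: add_mult mult_add)
  show "x * y * z = x * (y * z)"
  proof (induction x rule: tensor_induct)
    case (pure a b)
    show ?case
    proof (induction y rule: tensor_induct)
      case (pure c d)
      show ?case
        by (induction z rule: tensor_induct) (simp_all add: mult_pure mult.assoc add_mult mult_add)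
    qed (simp add: add_mult mult_add)
  qed (simp add: add_mult mult_add)
  show "1 * x = x"
    unfolding one_tensor_def
    by (induction x rule: tensor_induct) (simp_all add: mult_pure mult_add)
  obtain f :: "'a \<Rightarrow> complex" where f: "clinear f" "f 1 = 1"
    using functional_exists[of "1::'a"] by auto
  obtain g :: "'b \<Rightarrow> complex" where g: "clinear g" "g 1 = 1"
    using functional_exists[of "1::'b"] by auto
  have bil: "cbilinear (\<lambda>a b. f a * g b)"
    using f g by (simp add: cbilinear_def clinear_iff algebra_simps)
  have "tensor_lift (\<lambda>a b. f a * g b) (1 :: 'a \<otimes> 'b) = 1"
    using f g by (simp add: one_tensor_def bil)
  moreover have "tensor_lift (\<lambda>a b. f a * g b) (0 :: 'a \<otimes> 'b) = 0"
  proof -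
    interpret Vector_Spaces.linear scaleC scaleC "tensor_lift (\<lambda>a b. f a * g b)"
      by (rule clinear_tensor_lift[OF bil])
    show ?thesis by (rule zero)
  qed
  ultimately show "(0 :: 'a \<otimes> 'b) \<noteq> 1" by auto
qed

end

lemma tensor_mult_pure [simp]: "(a \<otimes> b) * (a' \<otimes> b') = (a * a') \<otimes> (b * b')"
  by (simp add: times_tensor_def tensor_mult_inner tensor_mult_inner' tensor_mult_outer)

section \<open>Finitely generated commutative star-algebras\<close>

text \<open>
  The free commutative star-algebra on \<open>'g\<close> is the polynomial algebra on the letters \<open>Inl g\<close>
  (the generator \<open>g\<close>) and \<open>Inr g\<close> (its adjoint).
\<close>

type_synonym 'g free_star = "(('g + 'g) \<Rightarrow>\<^sub>0 nat) \<Rightarrow>\<^sub>0 complex"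

definition letter :: "'g + 'g \<Rightarrow> 'g free_star" where
  "letter x = Poly_Mapping.single (Poly_Mapping.single x 1) 1"

definition swap_letter :: "'g + 'g \<Rightarrow> 'g + 'g" where
  "swap_letter = case_sum Inr Inl"

definition free_adj :: "'g free_star \<Rightarrow> 'g free_star" where
  "free_adj p = lin_ext (\<lambda>m. Poly_Mapping.single (Poly_Mapping.map_key swap_letter m) 1)
                        (Poly_Mapping.map cnj p)"

inductive_set star_ideal :: "'g free_star set \<Rightarrow> 'g free_star set" for R where
  rel: "r \<in> R \<Longrightarrow> r \<in> star_ideal R"
| zero: "0 \<in> star_ideal R"
| add: "x \<in> star_ideal R \<Longrightarrow> y \<in> star_ideal R \<Longrightarrow> x + y \<in> star_ideal R"
| mult: "x \<in> star_ideal R \<Longrightarrow> p * x \<in> star_ideal R"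
| adj: "x \<in> star_ideal R \<Longrightarrow> free_adj x \<in> star_ideal R"

lemma inj_swap_letter: "inj swap_letter"
  by (auto simp: swap_letter_def inj_def split: sum.splits)

lemma map_cnj_add: "Poly_Mapping.map cnj (p + q) = Poly_Mapping.map cnj p + Poly_Mapping.map cnj q"
  by (rule poly_mapping_eqI) (simp add: Poly_Mapping.map.rep_eq lookup_add when_def flip: complex_cnj_add)

lemma map_cnj_single [simp]:
  "Poly_Mapping.map cnj (Poly_Mapping.single k c) = Poly_Mapping.single k (cnj c)"
  by (rule poly_mapping_eqI) (simp add: Poly_Mapping.map.rep_eq lookup_single when_def)

lemma map_cnj_zero [simp]: "Poly_Mapping.map cnj 0 = 0"
  by (rule poly_mapping_eqI) (simp add: Poly_Mapping.map.rep_eq)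

lemma free_adj_zero [simp]: "free_adj 0 = 0"
  by (simp add: free_adj_def)

lemma free_adj_add: "free_adj (p + q) = free_adj p + free_adj q"
  by (simp add: free_adj_def map_cnj_add lin_ext_add)

lemma free_adj_single:
  "free_adj (Poly_Mapping.single m c) =
     Poly_Mapping.single (Poly_Mapping.map_key swap_letter m) (cnj c)"
  by (simp add: free_adj_def)

lemma free_adj_mult: "free_adj (p * q) = free_adj p * free_adj q"
  by (rule multiplicative_from_single)
     (auto simp: free_adj_add free_adj_single mult_single map_key_plus[OF inj_swap_letter])

lemma free_adj_diff: "free_adj (p - q) = free_adj p - free_adj q"
  by (metis add_diff_cancel_right' diff_add_cancel free_adj_add)

lemma free_adj_letter: "free_adj (letter x) = letter (swap_letter x)"
proof -
  have "swap_letter (swap_letter x) = x"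
    by (cases x) (simp_all add: swap_letter_def)
  then have "Poly_Mapping.map_key swap_letter (Poly_Mapping.single x (1::nat)) =
      Poly_Mapping.single (swap_letter x) 1"
    by (metis inj_swap_letter map_key_single)
  then show ?thesis by (simp add: letter_def free_adj_single)
qed

lemma free_adj_one [simp]: "free_adj 1 = 1"
  by (simp add: free_adj_single flip: single_one) (simp add: inj_swap_letter)

text \<open>Evaluation of a polynomial with values \<open>\<phi>\<close> of the letters.\<close>

definition mon_eval ::
    "('g::finite + 'g \<Rightarrow> 'c::comm_calgebra) \<Rightarrow> (('g + 'g) \<Rightarrow>\<^sub>0 nat) \<Rightarrow> 'c" where
  "mon_eval \<phi> m = (\<Prod>x\<in>UNIV. \<phi> x ^ Poly_Mapping.lookup m x)"

definition free_eval :: "('g::finite + 'g \<Rightarrow> 'c::comm_calgebra) \<Rightarrow> 'g free_star \<Rightarrow> 'c" where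
  "free_eval \<phi> = lin_ext (mon_eval \<phi>)"

lemma clinear_free_eval: "clinear (free_eval \<phi>)"
  by (simp add: free_eval_def clinear_lin_ext)

lemma free_eval_add: "free_eval \<phi> (p + q) = free_eval \<phi> p + free_eval \<phi> q"
  by (simp add: free_eval_def lin_ext_add)

lemma free_eval_diff: "free_eval \<phi> (p - q) = free_eval \<phi> p - free_eval \<phi> q"
  by (metis add_diff_cancel_right' diff_add_cancel free_eval_add)

lemma free_eval_mult: "free_eval \<phi> (p * q) = free_eval \<phi> p * free_eval \<phi> q"
  unfolding free_eval_def
  by (rule multiplicative_from_single)
     (simp_all add: lin_ext_add mon_eval_def lookup_add power_add prod.distrib mult.commute)

lemma free_eval_one [simp]: "free_eval \<phi> 1 = 1"
  by (simp add: free_eval_def mon_eval_def flip: single_one)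

lemma free_eval_letter [simp]: "free_eval \<phi> (letter x) = \<phi> x"
proof -
  have "(\<Prod>y\<in>UNIV. \<phi> y ^ (Suc 0 when x = y)) = (\<Prod>y\<in>UNIV. if x = y then \<phi> y else 1)"
    by (rule prod.cong) (auto simp: when_def)
  then show ?thesis
    by (simp add: free_eval_def letter_def mon_eval_def lookup_single)
qed

lemma star_ideal_singleton:
  assumes "x \<in> star_ideal {r}" "free_adj r = r"
  shows "\<exists>p. x = p * r"
  using assms(1)
proof induction
  case (rel s)
  then show ?case by (intro exI[of _ 1]) simp
next
  case zero
  show ?case by (intro exI[of _ 0]) simp
next
  case (add x y)
  then show ?case by (metis distrib_right)
next
  case (mult x p)
  then show ?case by (metis mult.assoc)
next
  case (adj x)
  then show ?case by (metis free_adj_mult assms(2))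
qed

subsection \<open>The coordinate algebra of the 3-sphere\<close>

datatype sphere_gen = Z1 | Z2

instance sphere_gen :: finite
proof
  have "(UNIV :: sphere_gen set) = {Z1, Z2}" using sphere_gen.exhaust by auto
  then show "finite (UNIV :: sphere_gen set)" using finite.simps by metis
qed

definition sphere_relation :: "sphere_gen free_star" where
  "sphere_relation =
     letter (Inr Z1) * letter (Inl Z1) + letter (Inr Z2) * letter (Inl Z2) - 1"

lemma free_adj_sphere_relation: "free_adj sphere_relation = sphere_relation"
  by (simp add: sphere_relation_def free_adj_add free_adj_diff free_adj_mult free_adj_letter
      swap_letter_def mult.commute)

definition sphere_rel :: "sphere_gen free_star \<Rightarrow> sphere_gen free_star \<Rightarrow> bool" where
  "sphere_rel p q \<longleftrightarrow> p - q \<in> star_ideal {sphere_relation}"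

lemma star_ideal_diff: "x \<in> star_ideal R \<Longrightarrow> y \<in> star_ideal R \<Longrightarrow> x - y \<in> star_ideal R"
  using star_ideal.add[of x R "(- 1) * y"] star_ideal.mult[of y R "- 1"] by simp

lemma equivp_sphere_rel: "equivp sphere_rel"
proof (rule equivpI)
  show "reflp sphere_rel"
    by (auto simp: reflp_def sphere_rel_def star_ideal.zero)
  show "symp sphere_rel"
    unfolding symp_def sphere_rel_def using star_ideal_diff[OF star_ideal.zero] by fastforce
  show "transp sphere_rel"
    unfolding transp_def sphere_rel_def
    by (intro allI impI, drule (1) star_ideal.add) (simp add: algebra_simps)
qed

quotient_type OS3 = "sphere_gen free_star" / sphere_rel
  by (rule equivp_sphere_rel)

lemma scaleC_eq_mult: "c *\<^sub>C p = Poly_Mapping.single 0 c * (p :: 'g free_star)"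
  by (metis mult_1 scaleC_mult_left scaleC_single single_one scaleC_complex_def mult.right_neutral)

lemma star_ideal_scaleC: "x \<in> star_ideal R \<Longrightarrow> c *\<^sub>C x \<in> star_ideal R"
  by (simp add: scaleC_eq_mult star_ideal.mult)

lemma sphere_relation_zero:
  assumes "\<phi> (Inr Z1) * \<phi> (Inl Z1) + \<phi> (Inr Z2) * \<phi> (Inl Z2) = 1" "sphere_rel p q"
  shows "free_eval \<phi> p = free_eval \<phi> q"
proof -
  have "free_eval \<phi> sphere_relation = 0"
    using assms(1) by (simp add: sphere_relation_def free_eval_diff free_eval_add free_eval_mult)
  moreover obtain s where "p - q = s * sphere_relation"
    using star_ideal_singleton[OF _ free_adj_sphere_relation] assms(2)
    by (auto simp: sphere_rel_def)
  ultimately have "free_eval \<phi> (p - q) = 0"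
    by (simp add: free_eval_mult)
  then show ?thesis by (simp add: free_eval_diff)
qed

instantiation OS3 :: comm_calgebra
begin
lift_definition zero_OS3 :: OS3 is 0 .
lift_definition one_OS3 :: OS3 is 1 .
lift_definition plus_OS3 :: "OS3 \<Rightarrow> OS3 \<Rightarrow> OS3" is "(+)"
  unfolding sphere_rel_def by (drule (1) star_ideal.add) (simp add: algebra_simps)
lift_definition minus_OS3 :: "OS3 \<Rightarrow> OS3 \<Rightarrow> OS3" is "(-)"
  unfolding sphere_rel_def by (drule (1) star_ideal_diff) (simp add: algebra_simps)
lift_definition uminus_OS3 :: "OS3 \<Rightarrow> OS3" is uminus
  unfolding sphere_rel_def
  by (drule star_ideal_diff[OF star_ideal.zero]) (simp add: algebra_simps)
lift_definition scaleC_OS3 :: "complex \<Rightarrow> OS3 \<Rightarrow> OS3" is scaleC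
  unfolding sphere_rel_def
  by (subst cvs.scale_right_diff_distrib[symmetric]) (rule star_ideal_scaleC)
lift_definition times_OS3 :: "OS3 \<Rightarrow> OS3 \<Rightarrow> OS3" is "(*)"
proof -
  fix p p' q q' :: "sphere_gen free_star"
  assume "sphere_rel p p'" "sphere_rel q q'"
  then have "q * (p - p') + p' * (q - q') \<in> star_ideal {sphere_relation}"
    by (simp add: sphere_rel_def star_ideal.add star_ideal.mult)
  then show "sphere_rel (p * q) (p' * q')"
    by (simp add: sphere_rel_def algebra_simps)
qed
instance
proof
  have "\<not> sphere_rel 0 1"
  proof
    assume "sphere_rel 0 1"
    then have "free_eval (\<lambda>x. if x = Inl Z1 \<or> x = Inr Z1 then 1 else 0 :: complex) 0 =
        free_eval (\<lambda>x. if x = Inl Z1 \<or> x = Inr Z1 then 1 else 0 :: complex) 1"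
      by (rule sphere_relation_zero[rotated]) simp
    then show False unfolding free_eval_one by (simp add: free_eval_def)
  qed
  then show "(0::OS3) \<noteq> 1" by transfer
qed (transfer; simp add: sphere_rel_def algebra_simps star_ideal.zero
       scaleC_add_right scaleC_add_left)+
end

definition sphere_z :: "sphere_gen \<Rightarrow> OS3" where
  "sphere_z i = abs_OS3 (letter (Inl i))"

definition sphere_zs :: "sphere_gen \<Rightarrow> OS3" where
  "sphere_zs i = abs_OS3 (letter (Inr i))"

lemma sphere_equation: "sphere_zs Z1 * sphere_z Z1 + sphere_zs Z2 * sphere_z Z2 = 1"
  unfolding sphere_z_def sphere_zs_def times_OS3.abs_eq plus_OS3.abs_eq one_OS3.abs_eq OS3.abs_eq_iff
  by (simp add: sphere_rel_def star_ideal.rel flip: sphere_relation_def)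

text \<open>The algebra map out of \<open>OS3\<close> with prescribed values of the letters \<open>z\<^sub>i\<close> and \<open>z\<^sub>i\<^sup>*\<close>.\<close>

definition sphere_hom :: "(sphere_gen + sphere_gen \<Rightarrow> 'c::comm_calgebra) \<Rightarrow> OS3 \<Rightarrow> 'c" where
  "sphere_hom \<phi> x = free_eval \<phi> (rep_OS3 x)"

definition calg_hom :: "('a::comm_calgebra \<Rightarrow> 'b::comm_calgebra) \<Rightarrow> bool" where
  "calg_hom F \<longleftrightarrow> clinear F \<and> (\<forall>x y. F (x * y) = F x * F y) \<and> F 1 = 1"

lemma sphere_hom:
  assumes "\<phi> (Inr Z1) * \<phi> (Inl Z1) + \<phi> (Inr Z2) * \<phi> (Inl Z2) = 1"
  shows "calg_hom (sphere_hom \<phi>)"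
    and "sphere_hom \<phi> (sphere_z i) = \<phi> (Inl i)"
    and "sphere_hom \<phi> (sphere_zs i) = \<phi> (Inr i)"
proof -
  have abs: "sphere_hom \<phi> (abs_OS3 p) = free_eval \<phi> p" for p
    unfolding sphere_hom_def
    by (rule sphere_relation_zero[OF assms])
       (simp add: Quotient3_rep_abs[OF Quotient3_OS3] equivp_reflp[OF equivp_sphere_rel])
  have ex: "\<exists>p. x = abs_OS3 p" for x
    by (metis Quotient3_abs_rep Quotient3_OS3)
  show "sphere_hom \<phi> (sphere_z i) = \<phi> (Inl i)" "sphere_hom \<phi> (sphere_zs i) = \<phi> (Inr i)"
    by (simp_all add: sphere_z_def sphere_zs_def abs)
  have "sphere_hom \<phi> (x + y) = sphere_hom \<phi> x + sphere_hom \<phi> y" for x y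
    using ex[of x] ex[of y] by (auto simp: plus_OS3.abs_eq abs free_eval_add)
  moreover have "sphere_hom \<phi> (x * y) = sphere_hom \<phi> x * sphere_hom \<phi> y" for x y
    using ex[of x] ex[of y] by (auto simp: times_OS3.abs_eq abs free_eval_mult)
  moreover have "sphere_hom \<phi> (c *\<^sub>C x) = c *\<^sub>C sphere_hom \<phi> x" for c x
    using ex[of x] by (auto simp: scaleC_OS3.abs_eq abs free_eval_def lin_ext_scaleC)
  ultimately show "calg_hom (sphere_hom \<phi>)"
    by (simp add: calg_hom_def clinear_iff one_OS3.abs_eq abs)
qed

section \<open>The Hopf algebras of the tori and their coactions on the 3-sphere\<close>

text \<open>
  The coordinate algebra of a torus is the group algebra of its character lattice;
  \<open>grp m\<close> is the basis element \<open>t\<^sub>m\<close>.  For the circle, \<open>grp n\<close> is \<open>t\<^sup>n\<close>, so that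
  \<open>grp (- 1)\<close> is \<open>t\<^sup>*\<close>.
\<close>

type_synonym OU1 = "int \<Rightarrow>\<^sub>0 complex"
type_synonym OT2 = "(int \<times> int) \<Rightarrow>\<^sub>0 complex"

definition grp :: "'g \<Rightarrow> 'g \<Rightarrow>\<^sub>0 complex" where
  "grp m = Poly_Mapping.single m 1"

definition comult :: "('g \<Rightarrow>\<^sub>0 complex) \<Rightarrow> ('g \<Rightarrow>\<^sub>0 complex) \<otimes> ('g \<Rightarrow>\<^sub>0 complex)" where
  "comult = lin_ext (\<lambda>m. grp m \<otimes> grp m)"

definition counit :: "('g \<Rightarrow>\<^sub>0 complex) \<Rightarrow> complex" where
  "counit = lin_ext (\<lambda>_. 1)"

lemma grp_mult: "grp m * grp m' = grp (m + m')" and grp_zero: "grp 0 = 1"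
  by (simp_all add: grp_def mult_single)

text \<open>\<open>OU1\<close> is generated by \<open>t\<close> and \<open>t\<^sup>*\<close> subject only to \<open>t\<^sup>* t = 1\<close>.\<close>

lemma OU1_universal:
  fixes u u' :: "'c::comm_calgebra"
  assumes "u' * u = 1"
  shows "\<exists>!F. calg_hom F \<and> F (grp (1::int)) = u \<and> F (grp (- 1)) = u'"
proof
  define w where "w n = (if n \<ge> 0 then u ^ nat n else u' ^ nat (- n))" for n
  have cancel: "u ^ k * u' ^ k = 1" for k
    by (metis assms mult.commute power_mult_distrib power_one)
  have w: "u ^ a * u' ^ b = w (int a - int b)" for a b
  proof (cases "b \<le> a")
    case True
    then have "u ^ a * u' ^ b = u ^ (a - b) * (u ^ b * u' ^ b)"
      by (simp add: power_add[symmetric] mult.assoc[symmetric])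
    with True show ?thesis by (simp add: cancel w_def nat_diff_distrib)
  next
    case False
    then have "u ^ a * u' ^ b = u' ^ (b - a) * (u ^ a * u' ^ a)"
      by (simp add: power_add[symmetric] mult.left_commute)
    with False show ?thesis by (simp add: cancel w_def nat_diff_distrib)
  qed
  have w_add: "w (m + n) = w m * w n" for m n
  proof -
    obtain a b c d where mn: "m = int a - int b" "n = int c - int d"
      by (metis int_diff_cases)
    then have "m + n = int (a + c) - int (b + d)" by simp
    then have "w (m + n) = u ^ (a + c) * u' ^ (b + d)" by (simp only: w)
    also have "\<dots> = (u ^ a * u' ^ b) * (u ^ c * u' ^ d)" by (simp add: power_add mult_ac)
    finally show ?thesis by (simp only: w mn)
  qed
  show "calg_hom (lin_ext w) \<and> lin_ext w (grp 1) = u \<and> lin_ext w (grp (- 1)) = u'"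
  proof (intro conjI)
    have "lin_ext w (p * q) = lin_ext w p * lin_ext w q" for p q
      by (rule multiplicative_from_single) (simp_all add: lin_ext_add w_add mult.commute)
    then show "calg_hom (lin_ext w)"
      by (simp add: calg_hom_def clinear_lin_ext flip: single_one) (simp add: w_def)
  qed (simp_all add: grp_def w_def)
  fix F assume F: "calg_hom F \<and> F (grp (1::int)) = u \<and> F (grp (- 1)) = u'"
  have pow: "F (grp (int k)) = u ^ k \<and> F (grp (- int k)) = u' ^ k" for k
  proof (induction k)
    case 0
    then show ?case using F by (simp add: calg_hom_def grp_zero)
  next
    case (Suc k)
    have "F (grp (a + b)) = F (grp a) * F (grp b)" for a b
      using F by (simp add: calg_hom_def flip: grp_mult)
    from this[of 1 "int k"] this[of "- 1" "- int k"] Suc F show ?case by simp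
  qed
  have "F (grp n) = w n" for n
  proof (cases "n \<ge> 0")
    case True then show ?thesis using pow[of "nat n"] by (simp add: w_def)
  next
    case False then show ?thesis using pow[of "nat (- n)"] by (simp add: w_def)
  qed
  moreover have "Poly_Mapping.single n c = c *\<^sub>C grp n" for n :: int and c
    by (simp add: grp_def)
  moreover have lin: "F (p + q) = F p + F q" "F (c *\<^sub>C p) = c *\<^sub>C F p" for p q c
    using F by (auto simp: calg_hom_def clinear_iff)
  moreover have "lin_ext w (grp n) = w n" for n
    by (simp add: grp_def)
  ultimately have single: "F (Poly_Mapping.single n c) = lin_ext w (Poly_Mapping.single n c)" for n c
    by (simp only: lin(2) lin_ext_scaleC)
  show "F = lin_ext w"
  proof
    fix p
    show "F p = lin_ext w p"
    proof (induction p rule: poly_mapping_single_induct)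
      case zero
      show ?case using single[of 0 0] by simp
    next
      case (add p q)
      then show ?case by (simp add: lin lin_ext_add)
    qed (rule single)
  qed
qed

definition hopf_coact :: "OS3 \<Rightarrow> OS3 \<otimes> OU1" where
  "hopf_coact = sphere_hom (case_sum (\<lambda>i. sphere_z i \<otimes> grp 1) (\<lambda>i. sphere_zs i \<otimes> grp (- 1)))"

fun sphere_weight :: "sphere_gen \<Rightarrow> int \<times> int" where
  "sphere_weight Z1 = (1, 0)"
| "sphere_weight Z2 = (0, 1)"

definition torus_coact :: "OS3 \<Rightarrow> OT2 \<otimes> OS3" where
  "torus_coact = sphere_hom (case_sum (\<lambda>i. grp (sphere_weight i) \<otimes> sphere_z i)
                              (\<lambda>i. grp (- sphere_weight i) \<otimes> sphere_zs i))"

lemma hopf_coact: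
  "calg_hom hopf_coact" "hopf_coact (sphere_z i) = sphere_z i \<otimes> grp 1" "hopf_coact (sphere_zs i) = sphere_zs i \<otimes> grp (- 1)"
proof -
  let ?\<phi> = "case_sum (\<lambda>i. sphere_z i \<otimes> (grp 1 :: OU1)) (\<lambda>i. sphere_zs i \<otimes> grp (- 1))"
  have "?\<phi> (Inr Z1) * ?\<phi> (Inl Z1) + ?\<phi> (Inr Z2) * ?\<phi> (Inl Z2) = 1"
    by (simp add: grp_mult grp_zero one_tensor_def sphere_equation flip: pure_tensor_simps)
  from sphere_hom[OF this] show "calg_hom hopf_coact"
      "hopf_coact (sphere_z i) = sphere_z i \<otimes> grp 1" "hopf_coact (sphere_zs i) = sphere_zs i \<otimes> grp (- 1)"
    by (simp_all add: hopf_coact_def)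
qed

lemma torus_coact:
  "calg_hom torus_coact" "torus_coact (sphere_z i) = grp (sphere_weight i) \<otimes> sphere_z i"
  "torus_coact (sphere_zs i) = grp (- sphere_weight i) \<otimes> sphere_zs i"
proof -
  let ?\<phi> = "case_sum (\<lambda>i. grp (sphere_weight i) \<otimes> sphere_z i)
                      (\<lambda>i. grp (- sphere_weight i) \<otimes> sphere_zs i)"
  have "?\<phi> (Inr Z1) * ?\<phi> (Inl Z1) + ?\<phi> (Inr Z2) * ?\<phi> (Inl Z2) = 1"
    by (simp add: grp_mult one_tensor_def sphere_equation grp_zero flip: pure_tensor_simps zero_prod_def)
  from sphere_hom[OF this] show "calg_hom torus_coact"
      "torus_coact (sphere_z i) = grp (sphere_weight i) \<otimes> sphere_z i"
      "torus_coact (sphere_zs i) = grp (- sphere_weight i) \<otimes> sphere_zs i"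
    by (simp_all add: torus_coact_def)
qed

definition base_algebra :: "OS3 set" where
  "base_algebra = {a. hopf_coact a = a \<otimes> 1}"

definition sphere_part :: "int \<times> int \<Rightarrow> int \<Rightarrow> OS3 set" where
  "sphere_part m n = {a. torus_coact a = grp m \<otimes> a \<and> hopf_coact a = a \<otimes> grp n}"

subsection \<open>The deformed product\<close>

definition cocycle :: "real \<Rightarrow> OT2 \<otimes> OT2 \<Rightarrow> complex" where
  "cocycle \<theta> = tensor_lift (\<lambda>k k'. lin_ext (\<lambda>m. lin_ext (\<lambda>m'.
            exp (pi * \<i> * \<theta> * of_int (fst m * snd m' - snd m * fst m'))) k') k)"

definition deformed_mult :: "real \<Rightarrow> OS3 \<Rightarrow> OS3 \<Rightarrow> OS3" where
  "deformed_mult \<theta> a a' =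
     tensor_lift (\<lambda>k a\<^sub>0. tensor_lift (\<lambda>k' a\<^sub>0'. cocycle \<theta> (k \<otimes> k') *\<^sub>C (a\<^sub>0 * a\<^sub>0')) (torus_coact a')) (torus_coact a)"

lemma cocycle_grp:
  "cocycle \<theta> (grp m \<otimes> grp m') = exp (pi * \<i> * \<theta> * of_int (fst m * snd m' - snd m * fst m'))"
  and clinear_cocycle: "clinear (cocycle \<theta>)"
proof -
  have "cbilinear (\<lambda>k k'. lin_ext (\<lambda>m. lin_ext (\<lambda>m'.
            exp (pi * \<i> * \<theta> * of_int (fst m * snd m' - snd m * fst m')) :: complex) k') k)"
    by (simp add: cbilinear_def clinear_iff lin_ext_add lin_ext_scaleC lin_ext_add_fun
        lin_ext_scaleC_fun del: scaleC_complex_def)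
  then show "cocycle \<theta> (grp m \<otimes> grp m') = exp (pi * \<i> * \<theta> * of_int (fst m * snd m' - snd m * fst m'))"
    "clinear (cocycle \<theta>)"
    by (simp_all add: cocycle_def grp_def clinear_tensor_lift)
qed

section \<open>Comodules, cotensor products and associated modules\<close>

definition left_comodule :: "('v::complex_vector \<Rightarrow> OU1 \<otimes> 'v) \<Rightarrow> bool" where
  "left_comodule \<rho> \<longleftrightarrow> clinear \<rho> \<and>
     (\<forall>v. tensor_assoc (tensor_map comult id (\<rho> v)) = tensor_map id \<rho> (\<rho> v)) \<and>
     (\<forall>v. tensor_lift (\<lambda>h w. counit h *\<^sub>C w) (\<rho> v) = v)"

definition comodule_hom ::
    "('v::complex_vector \<Rightarrow> OU1 \<otimes> 'v) \<Rightarrow> ('w::complex_vector \<Rightarrow> OU1 \<otimes> 'w) \<Rightarrow> ('v \<Rightarrow> 'w) \<Rightarrow> bool"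
  where "comodule_hom \<rho> \<rho>' f \<longleftrightarrow> clinear f \<and> (\<forall>v. \<rho>' (f v) = tensor_map id f (\<rho> v))"

definition comodule_part :: "('v::complex_vector \<Rightarrow> OU1 \<otimes> 'v) \<Rightarrow> int \<Rightarrow> 'v set" where
  "comodule_part \<rho> n = {v. \<rho> v = grp n \<otimes> v}"

definition cotensor ::
    "('m::complex_vector \<Rightarrow> 'm \<otimes> OU1) \<Rightarrow> ('v::complex_vector \<Rightarrow> OU1 \<otimes> 'v) \<Rightarrow> ('m \<otimes> 'v) set"
  where "cotensor \<delta> \<rho> = {x. tensor_assoc (tensor_map \<delta> id x) = tensor_map id \<rho> x}"

definition linear_on :: "'m::complex_vector set \<Rightarrow> ('m \<Rightarrow> 'n::complex_vector) \<Rightarrow> bool" where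
  "linear_on S F \<longleftrightarrow>
     (\<forall>x\<in>S. \<forall>y\<in>S. F (x + y) = F x + F y) \<and> (\<forall>c. \<forall>x\<in>S. F (c *\<^sub>C x) = c *\<^sub>C F x)"

record 'm lmodule =
  lm_carrier :: "'m set"
  lm_act :: "OS3 \<Rightarrow> 'm \<Rightarrow> 'm"

text \<open>
  Left modules over \<open>base_algebra\<close>, carried by a linear subspace of an ambient space \<open>'m\<close>.
  The action is constrained only on \<open>base_algebra\<close> and on the carrier.  The product of
  \<open>base_algebra\<close> is the one of \<open>OS3\<close>; every deformed product restricts to it.
\<close>

definition left_B_module :: "'m::complex_vector lmodule \<Rightarrow> bool" where
  "left_B_module M \<longleftrightarrow> cvs.subspace (lm_carrier M) \<and>
     (\<forall>b\<in>base_algebra. lm_act M b \<in> lm_carrier M \<rightarrow> lm_carrier M) \<and>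
     (\<forall>b\<in>base_algebra. linear_on (lm_carrier M) (lm_act M b)) \<and>
     (\<forall>x\<in>lm_carrier M. linear_on base_algebra (\<lambda>b. lm_act M b x)) \<and>
     (\<forall>b\<in>base_algebra. \<forall>c\<in>base_algebra. \<forall>x\<in>lm_carrier M.
        lm_act M (b * c) x = lm_act M b (lm_act M c x)) \<and>
     (\<forall>x\<in>lm_carrier M. lm_act M 1 x = x)"

definition B_module_hom ::
    "'m::complex_vector lmodule \<Rightarrow> 'n::complex_vector lmodule \<Rightarrow> ('m \<Rightarrow> 'n) \<Rightarrow> bool" where
  "B_module_hom M N F \<longleftrightarrow> left_B_module M \<and> left_B_module N \<and>
     F \<in> lm_carrier M \<rightarrow> lm_carrier N \<and> linear_on (lm_carrier M) F \<and>
     (\<forall>b\<in>base_algebra. \<forall>x\<in>lm_carrier M. F (lm_act M b x) = lm_act N b (F x))"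

definition B_module_iso ::
    "'m::complex_vector lmodule \<Rightarrow> 'n::complex_vector lmodule \<Rightarrow> ('m \<Rightarrow> 'n) \<Rightarrow> bool" where
  "B_module_iso M N F \<longleftrightarrow> B_module_hom M N F \<and> bij_betw F (lm_carrier M) (lm_carrier N)"

text \<open>
  The associated module functors on objects (\<open>E_A\<close>, \<open>E_A_deformed\<close>) and on morphisms (\<open>E_map\<close>).
  The deformed algebra is the comodule \<open>OS3\<close> with another product, so that both functors have the
  same carriers and the same values on morphisms.
\<close>

definition E_A :: "('v::complex_vector \<Rightarrow> OU1 \<otimes> 'v) \<Rightarrow> (OS3 \<otimes> 'v) lmodule" where
  "E_A \<rho> = \<lparr>lm_carrier = cotensor hopf_coact \<rho>, lm_act = (\<lambda>b. tensor_map (\<lambda>a. b * a) id)\<rparr>"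

definition E_A_deformed ::
    "real \<Rightarrow> ('v::complex_vector \<Rightarrow> OU1 \<otimes> 'v) \<Rightarrow> (OS3 \<otimes> 'v) lmodule" where
  "E_A_deformed \<theta> \<rho> =
     \<lparr>lm_carrier = cotensor hopf_coact \<rho>, lm_act = (\<lambda>b. tensor_map (\<lambda>a. deformed_mult \<theta> b a) id)\<rparr>"

definition E_map :: "('v::complex_vector \<Rightarrow> 'w::complex_vector) \<Rightarrow> OS3 \<otimes> 'v \<Rightarrow> OS3 \<otimes> 'w" where
  "E_map f = tensor_map id f"

text \<open>
  The defining property of \<open>L\<^sub>V\<close>, a linear map on the cotensor product;
  extensionality fixes its irrelevant values elsewhere.
\<close>

definition is_L ::
    "real \<Rightarrow> ('v::complex_vector \<Rightarrow> OU1 \<otimes> 'v) \<Rightarrow> (OS3 \<otimes> 'v \<Rightarrow> OS3 \<otimes> 'v) \<Rightarrow> bool" where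
  "is_L \<theta> \<rho> L \<longleftrightarrow> L \<in> extensional (cotensor hopf_coact \<rho>) \<and> linear_on (cotensor hopf_coact \<rho>) L \<and>
     (\<forall>m n. \<forall>a\<in>sphere_part (m + n, - m) n. \<forall>v\<in>comodule_part \<rho> n.
        L (a \<otimes> v) = exp (pi * \<i> * \<theta> * of_int (m * n)) *\<^sub>C (a \<otimes> v))"

definition L_iso :: "real \<Rightarrow> ('v::complex_vector \<Rightarrow> OU1 \<otimes> 'v) \<Rightarrow> OS3 \<otimes> 'v \<Rightarrow> OS3 \<otimes> 'v" where
  "L_iso \<theta> \<rho> = (THE L. is_L \<theta> \<rho> L)"

end

theory Submission
  imports Defs
begin

text \<open>
  The scalar \<open>exp (\<pi> \<i> \<theta> m n)\<close> depends only on the bidegree of \<open>a\<close>, so \<open>L\<close> is the restriction of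
  \<open>untwist \<theta> \<otimes> id\<close> for a diagonal automorphism \<open>untwist \<theta>\<close> of the vector space \<open>OS3\<close>.  For \<open>b\<close> of
  torus weight \<open>(k, -k)\<close> and Hopf degree 0 the cocycle contributes \<open>exp (\<pi> \<i> \<theta> k n)\<close>, whence
  \<open>untwist \<theta> (b a) = b \<star> untwist \<theta> a\<close> for all \<open>a\<close>: the deformed action is the classical one transported
  along \<open>untwist \<theta>\<close>, and inherits its module axioms.  For uniqueness, the cotensor product is spanned
  by the tensors of matching degree: on it, projecting the left factor to Hopf degree \<open>n\<close> agrees with
  projecting the right factor, and the projections of the left factor sum to the identity.
\<close>

section \<open>Linear maps between tensor products\<close>

lemma clinearD:
  assumes "clinear f"
  shows "f (x + y) = f x + f y" "f (c *\<^sub>C x) = c *\<^sub>C f x" "f 0 = 0"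
proof -
  interpret Vector_Spaces.linear scaleC scaleC f by (rule assms)
  show "f (x + y) = f x + f y" "f (c *\<^sub>C x) = c *\<^sub>C f x" "f 0 = 0"
    by (simp_all add: add scale)
qed

lemma clinear_id [simp]: "clinear id" "clinear (\<lambda>x. x)"
  by (simp_all add: clinear_iff)

lemma clinear_comp [simp]: "clinear f \<Longrightarrow> clinear g \<Longrightarrow> clinear (g \<circ> f)"
  by (simp add: clinear_iff)

lemma clinear_add: "clinear f \<Longrightarrow> clinear g \<Longrightarrow> clinear (\<lambda>x. f x + g x)"
  by (simp add: clinear_iff scaleC_add_right add_ac)

lemma clinear_mult [simp]: "clinear (\<lambda>a. b * (a :: 'a::comm_calgebra))"
  by (simp add: clinear_iff distrib_left)

lemma calg_hom_clinear: "calg_hom F \<Longrightarrow> clinear F"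
  by (simp add: calg_hom_def)

declare clinear_tensor_map [simp]

lemma tensor_map_linear [simp]:
  assumes "clinear f" "clinear g"
  shows "tensor_map f g (x + y) = tensor_map f g x + tensor_map f g y"
    "tensor_map f g (c *\<^sub>C x) = c *\<^sub>C tensor_map f g x" "tensor_map f g 0 = 0"
  by (rule clinearD, intro clinear_tensor_map assms)+

lemmas tensor_assoc_linear [simp] = clinear_tensor_assoc clinearD[OF clinear_tensor_assoc]

lemmas clinear_coact [simp] = calg_hom_clinear[OF hopf_coact(1)] calg_hom_clinear[OF torus_coact(1)]

lemmas coact_linear [simp] = clinearD[OF clinear_coact(1)] clinearD[OF clinear_coact(2)]

lemma tensor_map_compose:
  assumes "clinear f" "clinear g" "clinear f'" "clinear g'"
  shows "tensor_map f g (tensor_map f' g' x) = tensor_map (f \<circ> f') (g \<circ> g') x"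
proof -
  \<comment> \<open>The induction rule eta-expands \<open>f \<circ> f'\<close>, and \<open>simp\<close> would then unfold the composition.\<close>
  have "tensor_map f g (tensor_map f' g' x) = tensor_map h k x"
    if "clinear h" "clinear k" "\<And>a. f (f' a) = h a" "\<And>b. g (g' b) = k b" for h k
    by (induction x rule: tensor_induct) (simp_all add: assms that)
  then show ?thesis using assms by simp
qed

lemma tensor_map_ident [simp]: "tensor_map id id = id"
proof
  show "tensor_map id id x = id x" for x :: "'a \<otimes> 'b"
    by (induction x rule: tensor_induct) simp_all
qed

lemma tensor_assoc_natural:
  assumes "clinear f" "clinear g" "clinear h"
  shows "tensor_assoc (tensor_map (tensor_map f g) h x) =
    tensor_map f (tensor_map g h) (tensor_assoc x)"
proof (induction x rule: tensor_induct)
  case (pure y c)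
  show ?case
    by (induction y rule: tensor_induct)
       (simp_all add: pure_tensor_simps assms)
qed (simp add: assms)

section \<open>Contraction of a tensor factor against a linear functional\<close>

definition left_eval ::
    "('k::complex_vector \<Rightarrow> complex) \<Rightarrow> 'k \<otimes> 'v \<Rightarrow> 'v::complex_vector" where
  "left_eval f = tensor_lift (\<lambda>k v. f k *\<^sub>C v)"

definition right_eval ::
    "('k::complex_vector \<Rightarrow> complex) \<Rightarrow> 'v \<otimes> 'k \<Rightarrow> 'v::complex_vector" where
  "right_eval f = tensor_lift (\<lambda>v k. f k *\<^sub>C v)"

lemma left_eval:
  fixes f :: "'k::complex_vector \<Rightarrow> complex"
  assumes "clinear f"
  shows "clinear (left_eval f :: 'k \<otimes> 'v \<Rightarrow> 'v::complex_vector)"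
    "left_eval f (k \<otimes> (v :: 'v)) = f k *\<^sub>C v"
proof -
  have "cbilinear (\<lambda>k (v :: 'v). f k *\<^sub>C v)"
    using assms
    by (simp add: cbilinear_def clinear_iff scaleC_add_left scaleC_add_right mult.commute)
  then show "clinear (left_eval f :: 'k \<otimes> 'v \<Rightarrow> 'v)" "left_eval f (k \<otimes> v) = f k *\<^sub>C v"
    by (simp_all add: left_eval_def clinear_tensor_lift)
qed

lemma right_eval:
  fixes f :: "'k::complex_vector \<Rightarrow> complex"
  assumes "clinear f"
  shows "clinear (right_eval f :: 'v \<otimes> 'k \<Rightarrow> 'v::complex_vector)"
    "right_eval f ((v :: 'v) \<otimes> k) = f k *\<^sub>C v"
proof -
  have "cbilinear (\<lambda>(v :: 'v) k. f k *\<^sub>C v)"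
    using assms
    by (simp add: cbilinear_def clinear_iff scaleC_add_left scaleC_add_right mult.commute)
  then show "clinear (right_eval f :: 'v \<otimes> 'k \<Rightarrow> 'v)" "right_eval f (v \<otimes> k) = f k *\<^sub>C v"
    by (simp_all add: right_eval_def clinear_tensor_lift)
qed

declare left_eval [simp] right_eval [simp]

lemma eval_linear [simp]:
  assumes "clinear f"
  shows "left_eval f (x + y) = left_eval f x + left_eval f y"
    "left_eval f (c *\<^sub>C x) = c *\<^sub>C left_eval f x" "left_eval f 0 = 0"
    "right_eval f (x' + y') = right_eval f x' + right_eval f y'"
    "right_eval f (c *\<^sub>C x') = c *\<^sub>C right_eval f x'" "right_eval f 0 = 0"
  by (rule clinearD, intro left_eval right_eval assms)+

text \<open>The middle factor of a triple tensor can be contracted from either side of the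
  bracketing. This turns the cotensor equation into an equation between projections of the two outer
  factors.\<close>

lemma eval_tensor_assoc:
  assumes "clinear f"
  shows "tensor_map id (left_eval f) (tensor_assoc x) = tensor_map (right_eval f) id x"
proof (induction x rule: tensor_induct)
  case (pure y c)
  show ?case
    by (induction y rule: tensor_induct) (simp_all add: pure_tensor_simps assms)
qed (simp add: assms)

lemma left_eval_natural:
  assumes "clinear f" "clinear g"
  shows "left_eval f (tensor_map id g x) = g (left_eval f x)"
  by (induction x rule: tensor_induct)
     (simp_all add: assms clinearD[OF assms(2)])

abbreviation coeff :: "'k \<Rightarrow> ('k \<Rightarrow>\<^sub>0 complex) \<Rightarrow> complex" where
  "coeff n h \<equiv> Poly_Mapping.lookup h n"

lemma clinear_coeff [simp]: "clinear (coeff n)"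
  by (simp add: clinear_iff lookup_add)

lemma coeff_grp: "coeff n (grp k) = (if k = n then 1 else 0)"
  by (simp add: grp_def lookup_single when_def)

section \<open>The bigrading of the 3-sphere\<close>

text \<open>Every element is the class of a polynomial in the letters, so the property is propagated
  from letters to their powers, to monomials and to linear combinations.\<close>

lemma OS3_induct [case_names one z zs add scale mult]:
  assumes one: "P 1" and z: "\<And>i. P (sphere_z i)" "\<And>i. P (sphere_zs i)"
    and add: "\<And>x y. P x \<Longrightarrow> P y \<Longrightarrow> P (x + y)" and scale: "\<And>c x. P x \<Longrightarrow> P (c *\<^sub>C x)"
    and mult: "\<And>x y. P x \<Longrightarrow> P y \<Longrightarrow> P (x * y)"
  shows "P (a :: OS3)"
proof -
  have letter: "P (abs_OS3 (letter x))" for x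
    using z by (cases x) (simp_all add: sphere_z_def sphere_zs_def)
  have pow: "P (abs_OS3 (Poly_Mapping.single (Poly_Mapping.single x k) 1))" for x k
  proof (induction k)
    case 0
    show ?case using one by (simp add: one_OS3.abs_eq)
  next
    case (Suc k)
    have "Poly_Mapping.single (Poly_Mapping.single x (Suc k)) 1 =
      letter x * Poly_Mapping.single (Poly_Mapping.single x k) 1"
      by (simp add: letter_def mult_single flip: single_add)
    with mult[OF letter Suc] show ?case by (simp add: times_OS3.abs_eq)
  qed
  have mon: "P (abs_OS3 (Poly_Mapping.single m 1))" for m
  proof (induction m rule: poly_mapping_single_induct)
    case zero
    show ?case using one by (simp add: one_OS3.abs_eq)
  next
    case (single k c)
    show ?case by (rule pow)
  next
    case (add p q)
    from mult[OF this] show ?case by (simp add: times_OS3.abs_eq mult_single)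
  qed
  have single: "P (abs_OS3 (Poly_Mapping.single m c))" for m c
    using scale[OF mon[of m], of c] by (simp add: scaleC_OS3.abs_eq)
  have "P (abs_OS3 p)" for p
  proof (induction p rule: poly_mapping_single_induct)
    case zero
    \<comment> \<open>The rule has no case for zero; it is reached as a monomial with coefficient
      0.\<close>
    show ?case using single[of 0 0] by simp
  next
    case (add p q)
    from assms(4)[OF this] show ?case by (simp add: plus_OS3.abs_eq)
  qed (rule single)
  then show ?thesis by (metis Quotient3_abs_rep Quotient3_OS3)
qed

lemma sphere_part_mult:
  "a \<in> sphere_part m n \<Longrightarrow> a' \<in> sphere_part m' n' \<Longrightarrow> a * a' \<in> sphere_part (m + m') (n + n')"
  using hopf_coact(1) torus_coact(1) by (simp add: sphere_part_def calg_hom_def grp_mult)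

lemma one_in_sphere_part: "1 \<in> sphere_part 0 0"
  using hopf_coact(1) torus_coact(1) by (simp add: sphere_part_def calg_hom_def one_tensor_def grp_zero)

lemma sphere_part_scaleC: "a \<in> sphere_part m n \<Longrightarrow> c *\<^sub>C a \<in> sphere_part m n"
  by (simp add: sphere_part_def pure_tensor_simps)

lemma generators_in_sphere_part:
  "sphere_z i \<in> sphere_part (sphere_weight i) 1" "sphere_zs i \<in> sphere_part (- sphere_weight i) (- 1)"
  by (simp_all add: sphere_part_def hopf_coact torus_coact)

text \<open>The two coordinates of a torus weight add up to the Hopf degree, so for fixed
  \<open>n\<close> a single integer indexes the weights.\<close>

abbreviation hopf_component :: "int \<Rightarrow> OS3 set" where
  "hopf_component n \<equiv> \<Union>m. sphere_part (m + n, - m) n"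

text \<open>The unit and the generators satisfy the constraint that the weight coordinates sum to
  the Hopf degree. The constraint is additive under products, so the span is a subalgebra containing
  the generators.\<close>

lemma sphere_part_span: "a \<in> cvs.span (\<Union>n. hopf_component n)"
proof (induction a rule: OS3_induct)
  let ?G = "\<Union>n. hopf_component n"
  \<comment> \<open>The index \<open>m\<close> is recovered as minus the second coordinate of the
    weight.\<close>
  have mem: "a \<in> cvs.span ?G" if "a \<in> sphere_part w n" "fst w = n - snd w" for a w n
    using that by (intro cvs.span_base UN_I[of n] UN_I[of "- snd w"]) (auto simp: algebra_simps)
  {
    case one
    show ?case by (rule mem[OF one_in_sphere_part]) simp
  next
    case (z i)
    show ?case by (rule mem[OF generators_in_sphere_part(1)]) (cases i; simp)
  next
    case (zs i)
    show ?case by (rule mem[OF generators_in_sphere_part(2)]) (cases i; simp)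
  next
    case (add x y)
    then show ?case by (rule cvs.span_add)
  next
    case (scale c x)
    then show ?case by (intro cvs.span_scale)
  next
    case (mult x y)
    have uv: "u * v \<in> cvs.span ?G" if u: "u \<in> ?G" and v: "v \<in> ?G" for u v
    proof -
      obtain m n m' n' where "u \<in> sphere_part (m + n, - m) n" "v \<in> sphere_part (m' + n', - m') n'"
        using u v by auto
      from sphere_part_mult[OF this] show ?thesis by (rule mem) simp
    qed
    have uy: "u * y \<in> cvs.span ?G" if "u \<in> ?G" for u
      using mult(2)
    proof (induction rule: cvs.span_induct_alt)
      case (step c v w)
      from uv[OF that step(1)] step(2) show ?case
        by (simp add: distrib_left cvs.span_add cvs.span_scale)
    qed (simp add: cvs.span_zero)
    from mult(1) show ?case
    proof (induction rule: cvs.span_induct_alt)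
      case (step c u w)
      from uy[OF step(1)] step(2) show ?case by (simp add: distrib_right cvs.span_add cvs.span_scale)
    qed (simp add: cvs.span_zero)
  }
qed

text \<open>Scalars are absorbed into the homogeneous summands, so closure under addition
  suffices.\<close>

lemma sphere_part_induct [case_names part add]:
  assumes part: "\<And>m n a. a \<in> sphere_part (m + n, - m) n \<Longrightarrow> P a"
    and add: "\<And>x y. P x \<Longrightarrow> P y \<Longrightarrow> P (x + y)"
  shows "P a"
  using sphere_part_span[of a]
proof (induction rule: cvs.span_induct_alt)
  case base
  have "0 \<in> sphere_part (0 + 0, - 0) 0"
    using sphere_part_scaleC[OF one_in_sphere_part, of 0] by (simp add: zero_prod_def)
  then show ?case by (rule part)
next
  case (step c x y)
  then obtain m n where "x \<in> sphere_part (m + n, - m) n" by auto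
  then have "P (c *\<^sub>C x)" by (intro part sphere_part_scaleC)
  then show ?case using step(2) by (rule add)
qed

text \<open>The projection onto Hopf degree \<open>n\<close>, read off from the coaction as the
  coefficient of \<open>grp n\<close>; this makes it a linear map before anything is known about a
  direct sum decomposition.\<close>

definition hopf_proj :: "int \<Rightarrow> OS3 \<Rightarrow> OS3" where
  "hopf_proj n = right_eval (coeff n) \<circ> hopf_coact"

lemma clinear_hopf_proj: "clinear (hopf_proj n)"
  unfolding hopf_proj_def
  by (intro clinear_comp calg_hom_clinear hopf_coact right_eval clinear_coeff)

lemmas hopf_proj_linear [simp] = clinear_hopf_proj clinearD[OF clinear_hopf_proj]

lemma hopf_proj: "hopf_coact a = a \<otimes> grp k \<Longrightarrow> hopf_proj n a = (if k = n then a else 0)"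
  by (simp add: hopf_proj_def coeff_grp)

lemma hopf_proj_span: "hopf_proj n a \<in> cvs.span (hopf_component n)"
proof (induction a rule: sphere_part_induct)
  case (part m k a)
  then have "hopf_proj n a = (if k = n then a else 0)"
    by (intro hopf_proj) (simp add: sphere_part_def)
  with part show ?case by (auto simp: cvs.span_zero intro: cvs.span_base)
qed (simp add: cvs.span_add)

lemma hopf_proj_idem: "hopf_proj n \<circ> hopf_proj n = hopf_proj n"
proof
  show "(hopf_proj n \<circ> hopf_proj n) a = hopf_proj n a" for a
  proof (induction a rule: sphere_part_induct)
    case (part m k a)
    then have "hopf_proj n a = (if k = n then a else 0)"
      by (intro hopf_proj) (simp add: sphere_part_def)
    then show ?case by simp
  qed simp
qed

text \<open>Allowing every finite superset of \<open>N\<close> lets the index sets of two summands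
  be merged into their union.\<close>

lemma hopf_proj_sum:
  obtains N where "finite N" "\<And>M. finite M \<Longrightarrow> N \<subseteq> M \<Longrightarrow> (\<Sum>n\<in>M. hopf_proj n a) = a"
proof -
  have "\<exists>N. finite N \<and> (\<forall>M. finite M \<longrightarrow> N \<subseteq> M \<longrightarrow> (\<Sum>n\<in>M. hopf_proj n a) = a)"
  proof (induction a rule: sphere_part_induct)
    case (part m k a)
    then have "hopf_proj n a = (if k = n then a else 0)" for n
      by (intro hopf_proj) (simp add: sphere_part_def)
    then show ?case by (intro exI[of _ "{k}"]) simp
  next
    case (add x y)
    then obtain N N' where "finite N" "\<forall>M. finite M \<longrightarrow> N \<subseteq> M \<longrightarrow> (\<Sum>n\<in>M. hopf_proj n x) = x"
      "finite N'" "\<forall>M. finite M \<longrightarrow> N' \<subseteq> M \<longrightarrow> (\<Sum>n\<in>M. hopf_proj n y) = y"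
      by blast
    then show ?case
      by (intro exI[of _ "N \<union> N'"]) (simp add: sum.distrib)
  qed
  with that show ?thesis by blast
qed

text \<open>Since the unit is \<open>grp 0\<close>, coinvariants are fixed by the projection onto
  Hopf degree 0.\<close>

lemma base_algebra_span: "b \<in> base_algebra \<Longrightarrow> b \<in> cvs.span (hopf_component 0)"
  using hopf_proj_span[of 0 b] hopf_proj[of b 0 0] by (simp add: base_algebra_def grp_zero)

section \<open>The untwisting of the deformed product\<close>

text \<open>On the torus weight \<open>(m + n, - m)\<close> the integer in the exponent below is \<open>- m * n\<close>.\<close>

definition untwist :: "real \<Rightarrow> OS3 \<Rightarrow> OS3" where
  "untwist \<theta> =
     left_eval (lin_ext (\<lambda>m. exp (- pi * \<i> * \<theta> * of_int (snd m * (fst m + snd m))))) \<circ> torus_coact"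

lemma clinear_untwist: "clinear (untwist \<theta>)"
  unfolding untwist_def
  by (intro clinear_comp calg_hom_clinear torus_coact left_eval clinear_lin_ext)

lemmas untwist_linear [simp] = clinear_untwist clinearD[OF clinear_untwist]

lemma untwist_homogeneous:
  "torus_coact a = grp m \<otimes> a \<Longrightarrow>
    untwist \<theta> a = exp (- pi * \<i> * \<theta> * of_int (snd m * (fst m + snd m))) *\<^sub>C a"
  by (simp add: untwist_def clinear_lin_ext) (simp add: grp_def)

lemma untwist_sphere_part:
  assumes "a \<in> sphere_part (m + n, - m) n"
  shows "untwist \<theta> a = exp (pi * \<i> * \<theta> * of_int (m * n)) *\<^sub>C a"
  using untwist_homogeneous[of a "(m + n, - m)" \<theta>] assms by (simp add: sphere_part_def mult_ac)

lemma untwist_inverse: "untwist (- \<theta>) \<circ> untwist \<theta> = id"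
proof
  show "(untwist (- \<theta>) \<circ> untwist \<theta>) a = id a" for a
    by (induction a rule: sphere_part_induct)
       (simp_all add: untwist_sphere_part flip: exp_add)
qed

text \<open>A map acting by a scalar on each homogeneous part is colinear; hence it will preserve
  the cotensor product.\<close>

lemma hopf_coact_untwist: "hopf_coact (untwist \<theta> a) = tensor_map (untwist \<theta>) id (hopf_coact a)"
proof (induction a rule: sphere_part_induct)
  case (part m n a)
  then have "hopf_coact a = a \<otimes> grp n" by (simp add: sphere_part_def)
  with part show ?case by (simp add: untwist_sphere_part pure_tensor_simps)
qed simp

section \<open>The deformed product on homogeneous elements\<close>

lemma deformed_mult_cbilinear:
  "cbilinear (\<lambda>k' a\<^sub>0'. cocycle \<theta> (k \<otimes> k') *\<^sub>C (a\<^sub>0 * a\<^sub>0' :: OS3))"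
  "cbilinear (\<lambda>k a\<^sub>0. tensor_lift (\<lambda>k' a\<^sub>0'. cocycle \<theta> (k \<otimes> k') *\<^sub>C (a\<^sub>0 * a\<^sub>0' :: OS3)) y)"
proof -
  show "cbilinear (\<lambda>k' a\<^sub>0'. cocycle \<theta> (k \<otimes> k') *\<^sub>C (a\<^sub>0 * a\<^sub>0' :: OS3))"
    by (simp add: cbilinear_def clinear_iff pure_tensor_simps clinearD[OF clinear_cocycle]
        scaleC_add_left scaleC_add_right distrib_left mult.commute[of "_ :: complex"])
  have e: "cocycle \<theta> ((c *\<^sub>C k) \<otimes> k') *\<^sub>C (a * a') = c *\<^sub>C (cocycle \<theta> (k \<otimes> k') *\<^sub>C (a * a'))"
    "cocycle \<theta> (k \<otimes> k') *\<^sub>C ((c *\<^sub>C a) * a') = c *\<^sub>C (cocycle \<theta> (k \<otimes> k') *\<^sub>C (a * a'))"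
    for c k k' and a a' :: OS3
    by (simp_all add: pure_tensor_simps clinearD[OF clinear_cocycle] mult_ac)
  show "cbilinear (\<lambda>k a\<^sub>0. tensor_lift (\<lambda>k' a\<^sub>0'. cocycle \<theta> (k \<otimes> k') *\<^sub>C (a\<^sub>0 * a\<^sub>0' :: OS3)) y)"
    unfolding cbilinear_def clinear_iff e tensor_lift_scaleC_fun
    by (simp add: pure_tensor_simps clinearD[OF clinear_cocycle] scaleC_add_left scaleC_add_right
        distrib_right tensor_lift_add_fun)
qed

lemma deformed_mult_homogeneous:
  assumes "torus_coact a = grp m \<otimes> a" "torus_coact a' = grp m' \<otimes> a'"
  shows "deformed_mult \<theta> a a' =
    exp (pi * \<i> * \<theta> * of_int (fst m * snd m' - snd m * fst m')) *\<^sub>C (a * a')"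
proof -
  have "deformed_mult \<theta> a a' =
      tensor_lift (\<lambda>k' a\<^sub>0'. cocycle \<theta> (grp m \<otimes> k') *\<^sub>C (a * a\<^sub>0')) (grp m' \<otimes> a')"
    unfolding deformed_mult_def assms by (rule tensor_lift_pure[OF deformed_mult_cbilinear(2)])
  also have "\<dots> = cocycle \<theta> (grp m \<otimes> grp m') *\<^sub>C (a * a')"
    by (rule tensor_lift_pure[OF deformed_mult_cbilinear(1)])
  finally show ?thesis by (simp only: cocycle_grp)
qed

lemma clinear_deformed_mult:
  "clinear (\<lambda>a. deformed_mult \<theta> a a')" "clinear (deformed_mult \<theta> a)"
proof -
  show "clinear (\<lambda>a. deformed_mult \<theta> a a')"
    using clinear_comp[OF clinear_coact(2) clinear_tensor_lift[OF deformed_mult_cbilinear(2)]]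
    by (simp add: deformed_mult_def comp_def)
  show "clinear (deformed_mult \<theta> a)"
    by (simp add: deformed_mult_def clinear_iff
        clinearD[OF clinear_tensor_lift[OF deformed_mult_cbilinear(1)]]
        tensor_lift_add_fun tensor_lift_scaleC_fun)
qed

lemmas deformed_mult_linear [simp] = clinear_deformed_mult
  clinearD[OF clinear_deformed_mult(1)] clinearD[OF clinear_deformed_mult(2)]

text \<open>By linearity both factors may be taken homogeneous, of weights \<open>(k, - k)\<close>
  and \<open>(m + n, - m)\<close>. The cocycle exponent is then k(-m) + k(m + n) = kn, and (k + m)n
  = kn + mn matches the scalars on both sides.\<close>

lemma untwist_mult_base:
  assumes "b \<in> base_algebra"
  shows "untwist \<theta> (b * a) = deformed_mult \<theta> b (untwist \<theta> a)"
  using base_algebra_span[OF assms]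
proof (induction rule: cvs.span_induct_alt)
  case base
  show ?case by simp
next
  case (step c x y)
  from step(1) obtain k where x: "x \<in> sphere_part (k, - k) 0" by auto
  have "untwist \<theta> (x * a) = deformed_mult \<theta> x (untwist \<theta> a)"
  proof (induction a rule: sphere_part_induct)
    case (part m n a)
    have "x * a \<in> sphere_part ((k + m) + n, - (k + m)) n"
      using sphere_part_mult[OF x part] by (simp add: add_ac)
    then have "untwist \<theta> (x * a) = exp (pi * \<i> * \<theta> * of_int ((k + m) * n)) *\<^sub>C (x * a)"
      by (rule untwist_sphere_part)
    moreover have "deformed_mult \<theta> x a = exp (pi * \<i> * \<theta> * of_int (k * n)) *\<^sub>C (x * a)"
      using deformed_mult_homogeneous[of x "(k, - k)" a "(m + n, - m)" \<theta>] x part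
      by (simp add: sphere_part_def algebra_simps)
    moreover have "untwist \<theta> a = exp (pi * \<i> * \<theta> * of_int (m * n)) *\<^sub>C a"
      by (rule untwist_sphere_part[OF part])
    ultimately show ?case
      by (simp add: distrib_left distrib_right mult.commute flip: exp_add)
  qed (simp add: distrib_left)
  with step(2) show ?case by (simp add: distrib_right)
qed

section \<open>The cotensor product\<close>

text \<open>The counterpart of \<open>hopf_proj\<close> on a left comodule.\<close>

definition left_proj ::
    "('v \<Rightarrow> OU1 \<otimes> 'v) \<Rightarrow> int \<Rightarrow> 'v \<Rightarrow> 'v::complex_vector" where
  "left_proj \<rho> n = left_eval (coeff n) \<circ> \<rho>"

lemma clinear_left_proj: "left_comodule \<rho> \<Longrightarrow> clinear (left_proj \<rho> n)"
  unfolding left_proj_def left_comodule_def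
  by (intro clinear_comp left_eval clinear_coeff) simp

lemma left_eval_tensor_assoc:
  assumes "clinear f"
  shows "left_eval f (tensor_assoc x) = tensor_map (left_eval f) id x"
proof (induction x rule: tensor_induct)
  case (pure y c)
  show ?case
    by (induction y rule: tensor_induct)
       (simp_all add: pure_tensor_simps assms)
qed (simp add: assms)

lemma clinear_comult: "clinear comult"
  by (simp add: comult_def clinear_lin_ext)

lemmas comult_linear [simp] = clinear_comult clinearD[OF clinear_comult]

text \<open>Basis elements are grouplike, so contracting the first leg of \<open>comult h\<close>
  with \<open>coeff n\<close> leaves a multiple of \<open>grp n\<close>.\<close>

lemma left_eval_comult:
  "left_eval (coeff n) (tensor_assoc (tensor_map comult id x)) = grp n \<otimes> left_eval (coeff n) x"
proof -
  have "left_eval (coeff n) (comult h) = coeff n h *\<^sub>C grp n" for h :: "'a \<Rightarrow>\<^sub>0 complex"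
  proof (induction h rule: poly_mapping_single_induct)
    case (single k c)
    then show ?case
      by (simp add: comult_def coeff_grp lookup_single when_def)
  qed (simp_all add: lookup_add scaleC_add_left)
  then have "tensor_map (left_eval (coeff n)) id (tensor_map comult id x) =
      grp n \<otimes> left_eval (coeff n) x"
    by (induction x rule: tensor_induct)
       (simp_all add: pure_tensor_simps)
  then show ?thesis by (simp add: left_eval_tensor_assoc)
qed

text \<open>This is coassociativity with the first leg contracted by \<open>coeff n\<close>: one
  side becomes the coaction of the projected vector, the other its tensor with
  \<open>grp n\<close>.\<close>

lemma left_proj_in_comodule_part:
  assumes "left_comodule \<rho>"
  shows "left_proj \<rho> n v \<in> comodule_part \<rho> n"
proof -
  have "clinear \<rho>" and
    "tensor_assoc (tensor_map comult id (\<rho> v)) = tensor_map id \<rho> (\<rho> v)"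
    using assms by (simp_all add: left_comodule_def)
  then show ?thesis
    using left_eval_comult[of n "\<rho> v"]
    by (simp add: comodule_part_def left_proj_def left_eval_natural)
qed

text \<open>Contracting the middle factor of the defining equation with \<open>coeff n\<close>
  leaves \<open>hopf_proj n\<close> on one side and \<open>left_proj \<rho> n\<close> on the
  other.\<close>

lemma cotensor_proj:
  assumes "left_comodule \<rho>" "x \<in> cotensor hopf_coact \<rho>"
  shows "tensor_map (hopf_proj n) id x = tensor_map id (left_proj \<rho> n) x"
proof -
  have \<rho>: "clinear \<rho>" using assms(1) by (simp add: left_comodule_def)
  have "tensor_map id (left_eval (coeff n)) (tensor_assoc (tensor_map hopf_coact id x)) =
      tensor_map id (left_eval (coeff n)) (tensor_map id \<rho> x)"
    using assms(2) by (simp add: cotensor_def)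
  then show ?thesis
    by (simp add: eval_tensor_assoc tensor_map_compose \<rho> hopf_proj_def left_proj_def)
qed

lemma tensor_hopf_proj_sum:
  obtains N where "finite N" "(\<Sum>n\<in>N. tensor_map (hopf_proj n) id x) = x"
proof -
  have "\<exists>N. finite N \<and> (\<forall>M. finite M \<longrightarrow> N \<subseteq> M \<longrightarrow> (\<Sum>n\<in>M. tensor_map (hopf_proj n) id x) = x)"
  proof (induction x rule: tensor_induct)
    case (pure a v)
    obtain N where N: "finite N" "\<And>M. finite M \<Longrightarrow> N \<subseteq> M \<Longrightarrow> (\<Sum>n\<in>M. hopf_proj n a) = a"
      using hopf_proj_sum by blast
    have "(\<Sum>n\<in>M. hopf_proj n a \<otimes> v) = (\<Sum>n\<in>M. hopf_proj n a) \<otimes> v" if "finite M" for M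
      using that
    proof induction
      case empty
      show ?case by (metis pure_tensor_simps(3) cvs.scale_zero_left sum.empty)
    qed (simp add: pure_tensor_simps)
    with N show ?case
      by (intro exI[of _ N]) simp
  next
    case (add x y)
    then obtain N N' where
      "finite N" "\<forall>M. finite M \<longrightarrow> N \<subseteq> M \<longrightarrow> (\<Sum>n\<in>M. tensor_map (hopf_proj n) id x) = x"
      "finite N'" "\<forall>M. finite M \<longrightarrow> N' \<subseteq> M \<longrightarrow> (\<Sum>n\<in>M. tensor_map (hopf_proj n) id y) = y"
      by blast
    then show ?case
      by (intro exI[of _ "N \<union> N'"]) (simp add: sum.distrib del: id_apply)
  qed
  with that show ?thesis by blast
qed

text \<open>The tensors on which the defining formula of \<open>is_L\<close> prescribes
  values.\<close>

definition matched_tensors :: "('v::complex_vector \<Rightarrow> OU1 \<otimes> 'v) \<Rightarrow> (OS3 \<otimes> 'v) set" where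
  "matched_tensors \<rho> =
     {a \<otimes> v | a v m n. a \<in> sphere_part (m + n, - m) n \<and> v \<in> comodule_part \<rho> n}"

lemma cotensor_subset_span:
  assumes "left_comodule \<rho>" "x \<in> cotensor hopf_coact \<rho>"
  shows "x \<in> cvs.span (matched_tensors \<rho>)"
proof -
  note lin = clinear_left_proj[OF assms(1)]
  \<comment> \<open>Idempotence duplicates the left projection, and one of the two copies is traded
    for the right one.\<close>
  have both: "tensor_map (hopf_proj n) id x = tensor_map (hopf_proj n) (left_proj \<rho> n) x" for n
  proof -
    have "tensor_map (hopf_proj n) id x = tensor_map (hopf_proj n) id (tensor_map (hopf_proj n) id x)"
      by (simp add: tensor_map_compose hopf_proj_idem)
    also have "\<dots> = tensor_map (hopf_proj n) (left_proj \<rho> n) x"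
      by (simp add: cotensor_proj[OF assms] tensor_map_compose lin)
    finally show ?thesis .
  qed
  have matched: "a \<otimes> v \<in> cvs.span (matched_tensors \<rho>)"
    if "a \<in> cvs.span (hopf_component n)" "v \<in> comodule_part \<rho> n" for a v n
    using that(1)
  proof (induction rule: cvs.span_induct_alt)
    case base
    have "(0::OS3) \<otimes> v = 0" by (metis pure_tensor_simps(3) cvs.scale_zero_left)
    then show ?case by (simp add: cvs.span_zero)
  next
    case (step c a a')
    then have "a \<otimes> v \<in> matched_tensors \<rho>" using that(2) by (auto simp: matched_tensors_def)
    with step(2) show ?case
      by (simp add: pure_tensor_simps cvs.span_add cvs.span_scale cvs.span_base)
  qed
  \<comment> \<open>The two-sided projection maps every tensor into the span, inside the cotensor
    product or not, which permits induction over pure tensors.\<close>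
  have "tensor_map (hopf_proj n) (left_proj \<rho> n) y \<in> cvs.span (matched_tensors \<rho>)" for n y
  proof (induction y rule: tensor_induct)
    case (pure a v)
    have "hopf_proj n a \<otimes> left_proj \<rho> n v \<in> cvs.span (matched_tensors \<rho>)"
      by (rule matched[OF hopf_proj_span left_proj_in_comodule_part[OF assms(1)]])
    then show ?case by (simp add: lin)
  qed (simp add: lin cvs.span_add)
  with both have "tensor_map (hopf_proj n) id x \<in> cvs.span (matched_tensors \<rho>)" for n
    by simp
  then show ?thesis
    by (metis tensor_hopf_proj_sum cvs.span_sum)
qed

section \<open>Closure properties of the cotensor product\<close>

lemma matched_tensors_subset_cotensor:
  assumes "clinear \<rho>"
  shows "matched_tensors \<rho> \<subseteq> cotensor hopf_coact \<rho>"
  by (auto simp: matched_tensors_def cotensor_def sphere_part_def comodule_part_def assms)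

lemma subspace_cotensor:
  assumes "clinear \<rho>"
  shows "cvs.subspace (cotensor hopf_coact \<rho>)"
  by (rule cvs.subspaceI) (simp_all add: cotensor_def assms)

text \<open>Applied both to multiplication by elements of the base algebra and to
  \<open>untwist \<theta>\<close>.\<close>

lemma cotensor_map_left:
  assumes "clinear \<rho>" "clinear F" "\<And>a. hopf_coact (F a) = tensor_map F id (hopf_coact a)"
    "x \<in> cotensor hopf_coact \<rho>"
  shows "tensor_map F id x \<in> cotensor hopf_coact \<rho>"
proof -
  have comm: "hopf_coact \<circ> F = tensor_map F id \<circ> hopf_coact" using assms(3) by auto
  have "tensor_assoc (tensor_map hopf_coact id (tensor_map F id x)) =
      tensor_assoc (tensor_map (tensor_map F id) id (tensor_map hopf_coact id x))"
    by (simp add: tensor_map_compose assms(1,2) comm)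
  also have "\<dots> = tensor_map F id (tensor_assoc (tensor_map hopf_coact id x))"
    by (simp add: tensor_assoc_natural assms(1,2))
  also have "\<dots> = tensor_map id \<rho> (tensor_map F id x)"
    using assms(4) by (simp add: cotensor_def tensor_map_compose assms(1,2))
  finally show ?thesis by (simp add: cotensor_def)
qed

lemma cotensor_map_right:
  assumes "left_comodule \<rho>" "left_comodule \<rho>'" "comodule_hom \<rho> \<rho>' f"
    "x \<in> cotensor hopf_coact \<rho>"
  shows "tensor_map id f x \<in> cotensor hopf_coact \<rho>'"
proof -
  have \<rho>: "clinear \<rho>" "clinear \<rho>'" and f: "clinear f"
    using assms(1-3) by (simp_all add: left_comodule_def comodule_hom_def)
    have comm: "\<rho>' \<circ> f = tensor_map id f \<circ> \<rho>" using assms(3) by (auto simp: comodule_hom_def)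
  \<comment> \<open>The identity on the first two factors is written as
    \<open>tensor_map id id\<close> to match naturality of the associator.\<close>
  have "tensor_assoc (tensor_map hopf_coact id (tensor_map id f x)) =
      tensor_assoc (tensor_map (tensor_map id id) f (tensor_map hopf_coact id x))"
    by (simp add: tensor_map_compose \<rho> f)
  also have "\<dots> = tensor_map id (tensor_map id f) (tensor_map id \<rho> x)"
    using assms(4) unfolding tensor_assoc_natural[OF clinear_id(1) clinear_id(1) f]
    by (simp add: cotensor_def)
  also have "\<dots> = tensor_map id \<rho>' (tensor_map id f x)"
    by (simp add: tensor_map_compose \<rho> f comm)
  finally show ?thesis by (simp add: cotensor_def)
qed

section \<open>The associated modules\<close>

lemma linear_on_clinear: "clinear F \<Longrightarrow> linear_on S F"
  by (simp add: linear_on_def clinear_iff)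

text \<open>For coinvariant \<open>b\<close> the coaction of \<open>b * a\<close> is the coaction of
  \<open>a\<close> multiplied by \<open>b \<otimes> 1\<close>.\<close>

lemma hopf_coact_mult_base:
  "b \<in> base_algebra \<Longrightarrow> hopf_coact (b * a) = tensor_map (\<lambda>a. b * a) id (hopf_coact a)"
proof -
  assume b: "b \<in> base_algebra"
  have "(b \<otimes> 1) * y = tensor_map (\<lambda>a. b * a) id y" for y :: "OS3 \<otimes> OU1"
    by (induction y rule: tensor_induct) (simp_all add: distrib_left)
  with b show ?thesis
    using hopf_coact(1) by (simp add: calg_hom_def base_algebra_def)
qed

lemma base_algebra_mult: "b \<in> base_algebra \<Longrightarrow> c \<in> base_algebra \<Longrightarrow> b * c \<in> base_algebra"
  using hopf_coact(1) by (simp add: base_algebra_def calg_hom_def)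

lemma subspace_base_algebra: "cvs.subspace base_algebra"
proof -
  have "(0::OS3) \<otimes> (1::OU1) = 0" by (metis pure_tensor_simps(3) cvs.scale_zero_left)
  then show ?thesis
    by (intro cvs.subspaceI) (simp_all add: base_algebra_def pure_tensor_simps)
qed

lemma tensor_map_mult_linear:
  "clinear (\<lambda>b. tensor_map (\<lambda>a. b * a) id (x :: OS3 \<otimes> 'v::complex_vector))"
proof (induction x rule: tensor_induct)
  case (pure a v)
  have "tensor_map (\<lambda>a. b * a) id (a \<otimes> v) = (b * a) \<otimes> v" for b by simp
  then show ?case by (simp only: clinear_iff distrib_right pure_tensor_simps scaleC_mult_left) simp
next
  case (add x y)
  have "tensor_map (\<lambda>a. b * a) id (x + y) =
      tensor_map (\<lambda>a. b * a) id x + tensor_map (\<lambda>a. b * a) id y" for b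
    by simp
  with clinear_add[OF add] show ?case by (simp only:)
qed

lemma left_B_module_E_A:
  assumes "left_comodule \<rho>"
  shows "left_B_module (E_A \<rho>)"
proof -
  have \<rho>: "clinear \<rho>" using assms by (simp add: left_comodule_def)
  have "tensor_map (\<lambda>a. b * a) id \<in> cotensor hopf_coact \<rho> \<rightarrow> cotensor hopf_coact \<rho>"
    if "b \<in> base_algebra" for b
    using that by (auto intro!: cotensor_map_left \<rho> clinear_mult hopf_coact_mult_base)
  moreover have "(*) (b * c) = (*) b \<circ> (*) c" for b c :: OS3 by (auto simp: mult.assoc)
  moreover have "(*) (1 :: OS3) = id" by auto
  ultimately show ?thesis
    by (simp add: left_B_module_def E_A_def subspace_cotensor \<rho> linear_on_clinear
        tensor_map_mult_linear tensor_map_compose)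
qed

text \<open>An extension of \<open>L_iso\<close> to the whole tensor product, where it is a linear
  map in the unrestricted sense.\<close>

abbreviation L_ext :: "real \<Rightarrow> OS3 \<otimes> 'v \<Rightarrow> OS3 \<otimes> 'v::complex_vector" where
  "L_ext \<theta> \<equiv> tensor_map (untwist \<theta>) id"

lemma L_ext_inverse: "L_ext (- \<theta>) (L_ext \<theta> x) = x" "L_ext \<theta> (L_ext (- \<theta>) x) = x"
  using untwist_inverse[of \<theta>] untwist_inverse[of "- \<theta>"]
  by (simp_all add: tensor_map_compose)

lemma L_ext_cotensor:
  "clinear \<rho> \<Longrightarrow> x \<in> cotensor hopf_coact \<rho> \<Longrightarrow> L_ext \<theta> x \<in> cotensor hopf_coact \<rho>"
  by (intro cotensor_map_left clinear_untwist hopf_coact_untwist)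

lemma L_ext_act:
  assumes "b \<in> base_algebra"
  shows "L_ext \<theta> (tensor_map (\<lambda>a. b * a) id x) =
    tensor_map (\<lambda>a. deformed_mult \<theta> b a) id (L_ext \<theta> x)"
proof -
  have "untwist \<theta> \<circ> (*) b = deformed_mult \<theta> b \<circ> untwist \<theta>"
    using untwist_mult_base[OF assms] by auto
  then show ?thesis by (simp add: tensor_map_compose)
qed

lemma deformed_act:
  assumes "b \<in> base_algebra"
  shows "tensor_map (\<lambda>a. deformed_mult \<theta> b a) id x =
    L_ext \<theta> (tensor_map (\<lambda>a. b * a) id (L_ext (- \<theta>) x))"
  by (simp add: L_ext_act[OF assms] L_ext_inverse)

text \<open>After rewriting with \<open>deformed_act\<close>, adjacent factors
  \<open>L_ext (- \<theta>)\<close> and \<open>L_ext \<theta>\<close> cancel and the axioms of the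
  classical module remain.\<close>

lemma left_B_module_E_A_deformed:
  assumes "left_comodule \<rho>"
  shows "left_B_module (E_A_deformed \<theta> \<rho>)"
proof -
  have \<rho>: "clinear \<rho>" using assms by (simp add: left_comodule_def)
  have one: "1 \<in> base_algebra"
    using hopf_coact(1) by (simp add: base_algebra_def calg_hom_def one_tensor_def)
  note add = cvs.subspace_add[OF subspace_base_algebra]
    and scale = cvs.subspace_scale[OF subspace_base_algebra]
  from left_B_module_E_A[OF assms] have
    "cvs.subspace (cotensor hopf_coact \<rho>)"
    "\<And>b x. b \<in> base_algebra \<Longrightarrow> x \<in> cotensor hopf_coact \<rho> \<Longrightarrow>
       tensor_map (\<lambda>a. b * a) id x \<in> cotensor hopf_coact \<rho>"
    "\<And>b c x. b \<in> base_algebra \<Longrightarrow> c \<in> base_algebra \<Longrightarrow> x \<in> cotensor hopf_coact \<rho> \<Longrightarrow>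
       tensor_map (\<lambda>a. (b * c) * a) id x = tensor_map (\<lambda>a. b * a) id (tensor_map (\<lambda>a. c * a) id x)"
    "\<And>x. x \<in> cotensor hopf_coact \<rho> \<Longrightarrow> tensor_map (\<lambda>a. 1 * a) id x = x"
    unfolding left_B_module_def E_A_def Pi_iff lmodule.simps by blast+
  then show ?thesis
    using L_ext_cotensor[OF \<rho>] one
    by (simp add: left_B_module_def linear_on_def E_A_deformed_def deformed_act base_algebra_mult
        add scale Pi_iff L_ext_inverse clinearD[OF tensor_map_mult_linear]
        del: mult_1 mult_1_left scaleC_mult_left)
qed

lemma B_module_hom_E_map:
  assumes "left_comodule \<rho>" "left_comodule \<rho>'" "comodule_hom \<rho> \<rho>' f"
  shows "B_module_hom (E_A \<rho>) (E_A \<rho>') (E_map f)"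
    "B_module_hom (E_A_deformed \<theta> \<rho>) (E_A_deformed \<theta> \<rho>') (E_map f)"
proof -
  have f: "clinear f" using assms(3) by (simp add: comodule_hom_def)
  note simps = B_module_hom_def E_map_def Pi_iff linear_on_clinear f tensor_map_compose
  show "B_module_hom (E_A \<rho>) (E_A \<rho>') (E_map f)"
    using left_B_module_E_A[OF assms(1)] left_B_module_E_A[OF assms(2)] cotensor_map_right[OF assms]
    by (simp add: simps E_A_def)
  show "B_module_hom (E_A_deformed \<theta> \<rho>) (E_A_deformed \<theta> \<rho>') (E_map f)"
    using left_B_module_E_A_deformed[OF assms(1)] left_B_module_E_A_deformed[OF assms(2)]
      cotensor_map_right[OF assms]
    by (simp add: simps E_A_deformed_def)
qed

section \<open>The isomorphism\<close>

lemma is_L_L_ext: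
  assumes "left_comodule \<rho>"
  shows "is_L \<theta> \<rho> (restrict (L_ext \<theta>) (cotensor hopf_coact \<rho>))"
proof -
  have \<rho>: "clinear \<rho>" using assms by (simp add: left_comodule_def)
  note sub = subspace_cotensor[OF \<rho>]
  have "a \<otimes> v \<in> cotensor hopf_coact \<rho>"
    if "a \<in> sphere_part (m + n, - m) n" "v \<in> comodule_part \<rho> n" for a v m n
    using matched_tensors_subset_cotensor[OF \<rho>] that unfolding matched_tensors_def by blast
  then show ?thesis
    by (simp add: is_L_def linear_on_def cvs.subspace_add[OF sub] cvs.subspace_scale[OF sub]
        untwist_sphere_part pure_tensor_simps)
qed

lemma is_L_unique:
  assumes "left_comodule \<rho>" "is_L \<theta> \<rho> L" "is_L \<theta> \<rho> L'"
  shows "L = L'"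
proof (rule extensionalityI[of _ "cotensor hopf_coact \<rho>"])
  show "L \<in> extensional (cotensor hopf_coact \<rho>)" "L' \<in> extensional (cotensor hopf_coact \<rho>)"
    using assms(2,3) by (simp_all add: is_L_def)
  have \<rho>: "clinear \<rho>" using assms by (simp add: left_comodule_def)
  note sub = subspace_cotensor[OF \<rho>]
  have on: "F (x + y) = F x + F y" "F (c *\<^sub>C x) = c *\<^sub>C F x"
    if "F = L \<or> F = L'" "x \<in> cotensor hopf_coact \<rho>" "y \<in> cotensor hopf_coact \<rho>" for F x y c
    using that assms(2,3) by (auto simp: is_L_def linear_on_def)
  fix x assume "x \<in> cotensor hopf_coact \<rho>"
  from cotensor_subset_span[OF assms(1) this]
  \<comment> \<open>Membership is carried through the induction because both maps are linear only on
    the cotensor product.\<close>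
  have "x \<in> cotensor hopf_coact \<rho> \<and> L x = L' x"
  proof (induction rule: cvs.span_induct_alt)
    case base
    have z: "0 \<in> cotensor hopf_coact \<rho>" by (rule cvs.subspace_0[OF sub])
    \<comment> \<open>\<open>linear_on\<close> has no clause for zero; both values at 0 come from
      scaling by 0.\<close>
    show ?case using on(2)[OF _ z z, of L 0] on(2)[OF _ z z, of L' 0] z by simp
  next
    case (step c x y)
    have x: "x \<in> cotensor hopf_coact \<rho>"
      using matched_tensors_subset_cotensor[OF \<rho>] step(1) by blast
    have "L x = L' x"
      using step(1) assms(2,3) by (auto simp: matched_tensors_def is_L_def)
    with step(2) x show ?case
      by (simp add: on cvs.subspace_add[OF sub] cvs.subspace_scale[OF sub])
  qed
  then show "L x = L' x" by simp
qed

lemma L_iso_eq: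
  assumes "left_comodule \<rho>"
  shows "L_iso \<theta> \<rho> = restrict (L_ext \<theta>) (cotensor hopf_coact \<rho>)"
  unfolding L_iso_def
  using is_L_L_ext[OF assms] is_L_unique[OF assms] by blast

lemma B_module_iso_L_iso:
  assumes "left_comodule \<rho>"
  shows "B_module_iso (E_A \<rho>) (E_A_deformed \<theta> \<rho>) (L_iso \<theta> \<rho>)"
proof -
  have \<rho>: "clinear \<rho>" using assms by (simp add: left_comodule_def)
  have E_A: "left_B_module (E_A \<rho>)" by (rule left_B_module_E_A[OF assms])
  have "bij_betw (L_ext \<theta>) (cotensor hopf_coact \<rho>) (cotensor hopf_coact \<rho>)"
    by (rule bij_betw_byWitness[where f' = "L_ext (- \<theta>)"])
       (auto simp: L_ext_inverse intro: L_ext_cotensor[OF \<rho>])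
  moreover have "linear_on (cotensor hopf_coact \<rho>) (restrict (L_ext \<theta>) (cotensor hopf_coact \<rho>))"
    using is_L_L_ext[OF assms] by (simp add: is_L_def)
  ultimately show ?thesis
    using E_A left_B_module_E_A_deformed[OF assms, of \<theta>] L_ext_cotensor[OF \<rho>]
    by (simp add: B_module_iso_def B_module_hom_def L_iso_eq[OF assms] E_A_def E_A_deformed_def
        L_ext_act left_B_module_def Pi_iff)
qed

text \<open>The maps act on different tensor factors and therefore commute;
  \<open>cotensor_map_right\<close> ensures that \<open>E_map f x\<close> stays where
  \<open>L_iso\<close> agrees with \<open>L_ext\<close>.\<close>

lemma L_iso_natural:
  assumes "left_comodule \<rho>" "left_comodule \<rho>'" "comodule_hom \<rho> \<rho>' f" "x \<in> cotensor hopf_coact \<rho>"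
  shows "L_iso \<theta> \<rho>' (E_map f x) = E_map f (L_iso \<theta> \<rho> x)"
proof -
  have "clinear f" using assms(3) by (simp add: comodule_hom_def)
  then show ?thesis
    using assms(4) cotensor_map_right[OF assms]
    by (simp add: L_iso_eq assms(1,2) E_map_def tensor_map_compose)
qed

theorem proposition3p3:
  fixes \<theta> :: real
    and \<rho>U :: "'u::complex_vector \<Rightarrow> OU1 \<otimes> 'u"
    and \<rho>V :: "'v::complex_vector \<Rightarrow> OU1 \<otimes> 'v"
    and \<rho>W :: "'w::complex_vector \<Rightarrow> OU1 \<otimes> 'w"
  assumes "left_comodule \<rho>U" and "left_comodule \<rho>V" and "left_comodule \<rho>W"
  shows
    \<comment> \<open>\<open>L\<^sub>V\<close> is well defined\<close>
    "(\<exists>!L. is_L \<theta> \<rho>V L) \<and> is_L \<theta> \<rho>V (L_iso \<theta> \<rho>V) \<and>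
     \<comment> \<open>\<open>L\<^sub>V\<close> is an isomorphism of left modules over the base algebra\<close>
     B_module_iso (E_A \<rho>V) (E_A_deformed \<theta> \<rho>V) (L_iso \<theta> \<rho>V) \<and>
     \<comment> \<open>functoriality of the two associated module constructions\<close>
     (\<forall>f. comodule_hom \<rho>V \<rho>W f \<longrightarrow>
        B_module_hom (E_A \<rho>V) (E_A \<rho>W) (E_map f) \<and>
        B_module_hom (E_A_deformed \<theta> \<rho>V) (E_A_deformed \<theta> \<rho>W) (E_map f)) \<and>
     (\<forall>x \<in> lm_carrier (E_A \<rho>V) \<union> lm_carrier (E_A_deformed \<theta> \<rho>V). E_map id x = x) \<and>
     (\<forall>f g. comodule_hom \<rho>U \<rho>V f \<longrightarrow> comodule_hom \<rho>V \<rho>W g \<longrightarrow>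
        (\<forall>x \<in> lm_carrier (E_A \<rho>U) \<union> lm_carrier (E_A_deformed \<theta> \<rho>U).
           E_map (g \<circ> f) x = E_map g (E_map f x))) \<and>
     \<comment> \<open>naturality of \<open>L\<close>\<close>
     (\<forall>f. comodule_hom \<rho>V \<rho>W f \<longrightarrow>
        (\<forall>x \<in> lm_carrier (E_A \<rho>V). L_iso \<theta> \<rho>W (E_map f x) = E_map f (L_iso \<theta> \<rho>V x)))"
proof (intro conjI ballI allI impI)
  show "\<exists>!L. is_L \<theta> \<rho>V L"
    using is_L_L_ext[OF assms(2)] is_L_unique[OF assms(2)] by blast
  show "is_L \<theta> \<rho>V (L_iso \<theta> \<rho>V)"
    using is_L_L_ext[OF assms(2)] by (simp add: L_iso_eq[OF assms(2)])
  show "B_module_iso (E_A \<rho>V) (E_A_deformed \<theta> \<rho>V) (L_iso \<theta> \<rho>V)"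
    by (rule B_module_iso_L_iso[OF assms(2)])
  show "B_module_hom (E_A \<rho>V) (E_A \<rho>W) (E_map f)"
    "B_module_hom (E_A_deformed \<theta> \<rho>V) (E_A_deformed \<theta> \<rho>W) (E_map f)"
    if "comodule_hom \<rho>V \<rho>W f" for f
    using B_module_hom_E_map[OF assms(2,3) that] by auto
  show "E_map id x = x" for x :: "OS3 \<otimes> 'v"
    by (simp add: E_map_def)
  show "E_map (g \<circ> f) x = E_map g (E_map f x)"
    if "comodule_hom \<rho>U \<rho>V f" "comodule_hom \<rho>V \<rho>W g" for f g x
    using that by (simp add: E_map_def comodule_hom_def tensor_map_compose)
  show "L_iso \<theta> \<rho>W (E_map f x) = E_map f (L_iso \<theta> \<rho>V x)"
    if "comodule_hom \<rho>V \<rho>W f" "x \<in> lm_carrier (E_A \<rho>V)" for f x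
    using that by (intro L_iso_natural[OF assms(2,3)]) (simp_all add: E_A_def)
qed

end
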